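(* Let $X$ be a real $n \times p$ matrix with $p < n$ and of full rank $p$. Let $C$ be a non-singular $p \times p$ matrix such that $XC^{-1}$ has orthonormal columns. Then there exist an $n \times (n-p)$ matrix $M$ whose columns are an orthonormal basis for $\mathrm{col}(X)^{\perp}$, and a $p \times p$ matrix $S$ having the same rank as $C - X^{(p)}$, such that for all $x \in \mathrm{col}(X)^{\perp}$, $$M^T x = x_{(p)} + X_{(p)} S x^{(p)}.$$ If $C - X^{(p)}$ is non-singular, then $S = \left( C - X^{(p)} \right)^{-1}$; in any case, $S$ can be computed in $O(p^3)$ time.
   Context: For a matrix or column vector $A$ with $n$ rows, $A^{(p)}$ denotes the first $p$ rows of $A$ and $A_{(p)}$ the last $n-p$ rows. $\mathrm{col}(X)$ is the column space of $X$, and $\perp$ denotes orthogonal complement in $\mathbb{R}^n$ with the Euclidean inner product. Time is counted as the number of arithmetic operations on (and comparisons of) real numbers, the input data being $X^{(p)}$ and $C$. *)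

theory Defs
  imports
    "Jordan_Normal_Form.DL_Rank"
    "Jordan_Normal_Form.Gauss_Jordan_Elimination"
    "HOL-Library.Landau_Symbols"
begin

section \<open>Linear algebra\<close>

definition first_rows :: "nat \<Rightarrow> real mat \<Rightarrow> real mat" where
  "first_rows p A = mat p (dim_col A) (\<lambda>(i, j). A $$ (i, j))"

definition last_rows :: "nat \<Rightarrow> real mat \<Rightarrow> real mat" where
  "last_rows k A = mat k (dim_col A) (\<lambda>(i, j). A $$ (dim_row A - k + i, j))"

text \<open>The argument \<open>k\<close> of \<open>last_rows\<close> is the number of rows kept, as in \<^const>\<open>vec_last\<close>;
  so the last \<open>n - p\<close> rows of an \<open>n\<close>-row matrix \<open>A\<close> are \<open>last_rows (n - p) A\<close>.\<close>

definition orthonormal_cols :: "real mat \<Rightarrow> bool" where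
  "orthonormal_cols A \<longleftrightarrow>
     (\<forall>i < dim_col A. \<forall>j < dim_col A. col A i \<bullet> col A j = (if i = j then 1 else 0))"

text \<open>The subspace \<open>W\<close> of the space of \<open>n\<close>-vectors is regarded as a vector space by restricting
  the carrier.\<close>

definition cols_orthonormal_basis :: "nat \<Rightarrow> real mat \<Rightarrow> real vec set \<Rightarrow> bool" where
  "cols_orthonormal_basis n M W \<longleftrightarrow>
     orthonormal_cols M \<and>
     vectorspace.basis class_ring ((module_vec TYPE(real) n)\<lparr>carrier := W\<rparr>) (set (cols M))"

section \<open>A uniform model of computation over the reals\<close>

text \<open>
  Programs of a while language act on natural-number variables, used for indexing and control, and
  on two-dimensional arrays of exact real numbers. The only operations on reals are the four
  arithmetic operations and the comparisons \<open><\<close> and \<open>=\<close>. The cost of a run is the number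
  of these; indexing, control flow and copying are not counted. The only information that passes
  from the reals to the natural-number variables is the outcome of the counted comparisons.
\<close>

datatype iexp =
    INum nat
  | IVar string
  | IAdd iexp iexp
  | ISub iexp iexp
  | IMul iexp iexp

datatype rexp =
    RNum int
  | RElem string iexp iexp
  | RAdd rexp rexp
  | RSub rexp rexp
  | RMul rexp rexp
  | RDiv rexp rexp

datatype bexp =
    ILess iexp iexp
  | RLess rexp rexp
  | REq rexp rexp
  | BNot bexp
  | BAnd bexp bexp

datatype com =
    Skip
  | IAssign string iexp
  | RAssign string iexp iexp rexp
  | Seq com com
  | Cond bexp com com
  | While bexp com

type_synonym istore = "string \<Rightarrow> nat"
type_synonym rstore = "string \<Rightarrow> nat \<times> nat \<Rightarrow> real"

fun ival :: "iexp \<Rightarrow> istore \<Rightarrow> nat" where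
  "ival (INum k) s = k"
| "ival (IVar x) s = s x"
| "ival (IAdd a b) s = ival a s + ival b s"
| "ival (ISub a b) s = ival a s - ival b s"
| "ival (IMul a b) s = ival a s * ival b s"

fun rval :: "rexp \<Rightarrow> istore \<Rightarrow> rstore \<Rightarrow> real" where
  "rval (RNum k) s m = of_int k"
| "rval (RElem v i j) s m = m v (ival i s, ival j s)"
| "rval (RAdd a b) s m = rval a s m + rval b s m"
| "rval (RSub a b) s m = rval a s m - rval b s m"
| "rval (RMul a b) s m = rval a s m * rval b s m"
| "rval (RDiv a b) s m = rval a s m / rval b s m"

text \<open>Division by zero is an error: a program evaluating an expression that is not well-defined
  has no run.\<close>

fun rdefined :: "rexp \<Rightarrow> istore \<Rightarrow> rstore \<Rightarrow> bool" where
  "rdefined (RNum k) s m = True"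
| "rdefined (RElem v i j) s m = True"
| "rdefined (RAdd a b) s m = (rdefined a s m \<and> rdefined b s m)"
| "rdefined (RSub a b) s m = (rdefined a s m \<and> rdefined b s m)"
| "rdefined (RMul a b) s m = (rdefined a s m \<and> rdefined b s m)"
| "rdefined (RDiv a b) s m = (rdefined a s m \<and> rdefined b s m \<and> rval b s m \<noteq> 0)"

fun rcost :: "rexp \<Rightarrow> nat" where
  "rcost (RNum k) = 0"
| "rcost (RElem v i j) = 0"
| "rcost (RAdd a b) = rcost a + rcost b + 1"
| "rcost (RSub a b) = rcost a + rcost b + 1"
| "rcost (RMul a b) = rcost a + rcost b + 1"
| "rcost (RDiv a b) = rcost a + rcost b + 1"

fun bval :: "bexp \<Rightarrow> istore \<Rightarrow> rstore \<Rightarrow> bool" where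
  "bval (ILess a b) s m = (ival a s < ival b s)"
| "bval (RLess a b) s m = (rval a s m < rval b s m)"
| "bval (REq a b) s m = (rval a s m = rval b s m)"
| "bval (BNot b) s m = (\<not> bval b s m)"
| "bval (BAnd b c) s m = (bval b s m \<and> bval c s m)"

fun bdefined :: "bexp \<Rightarrow> istore \<Rightarrow> rstore \<Rightarrow> bool" where
  "bdefined (ILess a b) s m = True"
| "bdefined (RLess a b) s m = (rdefined a s m \<and> rdefined b s m)"
| "bdefined (REq a b) s m = (rdefined a s m \<and> rdefined b s m)"
| "bdefined (BNot b) s m = bdefined b s m"
| "bdefined (BAnd b c) s m = (bdefined b s m \<and> bdefined c s m)"

text \<open>Both conjuncts of \<open>BAnd\<close> are evaluated, and both are charged.\<close>

fun bcost :: "bexp \<Rightarrow> nat" where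
  "bcost (ILess a b) = 0"
| "bcost (RLess a b) = rcost a + rcost b + 1"
| "bcost (REq a b) = rcost a + rcost b + 1"
| "bcost (BNot b) = bcost b"
| "bcost (BAnd b c) = bcost b + bcost c"

text \<open>\<open>exec c (s, m) t (s', m')\<close>: started in state \<open>(s, m)\<close>, the program \<open>c\<close> terminates in
  state \<open>(s', m')\<close> after exactly \<open>t\<close> real operations.\<close>

inductive exec :: "com \<Rightarrow> istore \<times> rstore \<Rightarrow> nat \<Rightarrow> istore \<times> rstore \<Rightarrow> bool" where
  exec_Skip: "exec Skip st 0 st"
| exec_IAssign: "exec (IAssign x a) (s, m) 0 (s(x := ival a s), m)"
| exec_RAssign: "rdefined e s m \<Longrightarrow>
    exec (RAssign v i j e) (s, m) (rcost e)
      (s, m(v := (m v)((ival i s, ival j s) := rval e s m)))"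
| exec_Seq: "exec c st t st' \<Longrightarrow> exec d st' u st'' \<Longrightarrow> exec (Seq c d) st (t + u) st''"
| exec_CondT: "bdefined b s m \<Longrightarrow> bval b s m \<Longrightarrow> exec c (s, m) t st' \<Longrightarrow>
    exec (Cond b c d) (s, m) (bcost b + t) st'"
| exec_CondF: "bdefined b s m \<Longrightarrow> \<not> bval b s m \<Longrightarrow> exec d (s, m) t st' \<Longrightarrow>
    exec (Cond b c d) (s, m) (bcost b + t) st'"
| exec_WhileF: "bdefined b s m \<Longrightarrow> \<not> bval b s m \<Longrightarrow>
    exec (While b c) (s, m) (bcost b) (s, m)"
| exec_WhileT: "bdefined b s m \<Longrightarrow> bval b s m \<Longrightarrow> exec c (s, m) t st' \<Longrightarrow>
    exec (While b c) st' u st'' \<Longrightarrow>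
    exec (While b c) (s, m) (bcost b + t + u) st''"

inductive_cases exec_SkipE: "exec Skip st t st'"
inductive_cases exec_IAssignE: "exec (IAssign x a) st t st'"
inductive_cases exec_RAssignE: "exec (RAssign v i j e) st t st'"
inductive_cases exec_SeqE: "exec (Seq c d) st t st'"
inductive_cases exec_CondE: "exec (Cond b c d) st t st'"
inductive_cases exec_WhileE: "exec (While b c) st t st'"

lemma exec_deterministic:
  "exec c st t st' \<Longrightarrow> exec c st u st'' \<Longrightarrow> u = t \<and> st'' = st'"
proof (induction arbitrary: u st'' rule: exec.induct)
  case (exec_Skip st)
  then show ?case by (auto elim: exec_SkipE)
next
  case (exec_IAssign x a s m)
  then show ?case by (auto elim: exec_IAssignE)
next
  case (exec_RAssign e s m v i j)
  from exec_RAssign.prems show ?case by (auto elim: exec_RAssignE)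
next
  case (exec_Seq c st t1 st1 d t2 st2)
  from exec_Seq.prems obtain u1 u2 st3
    where "exec c st u1 st3" "exec d st3 u2 st''" "u = u1 + u2"
    by (rule exec_SeqE)
  with exec_Seq.IH(1)[of u1 st3] exec_Seq.IH(2)[of u2 st''] show ?case by simp
next
  case (exec_CondT b s m c t1 st1 d)
  from exec_CondT.prems obtain u1 where "exec c (s, m) u1 st''" "u = bcost b + u1"
    by (rule exec_CondE) (use exec_CondT.hyps in simp_all)
  with exec_CondT.IH[of u1 st''] show ?case by simp
next
  case (exec_CondF b s m d t1 st1 c)
  from exec_CondF.prems obtain u1 where "exec d (s, m) u1 st''" "u = bcost b + u1"
    by (rule exec_CondE) (use exec_CondF.hyps in simp_all)
  with exec_CondF.IH[of u1 st''] show ?case by simp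
next
  case (exec_WhileF b s m c)
  from exec_WhileF.prems show ?case
    by (rule exec_WhileE) (use exec_WhileF.hyps in simp_all)
next
  case (exec_WhileT b s m c t1 st1 t2 st2)
  from exec_WhileT.prems obtain u1 u2 st3
    where "exec c (s, m) u1 st3" "exec (While b c) st3 u2 st''" "u = bcost b + u1 + u2"
    by (rule exec_WhileE) (use exec_WhileT.hyps in simp_all)
  with exec_WhileT.IH(1)[of u1 st3] exec_WhileT.IH(2)[of u2 st''] show ?case by simp
qed

definition array_of_mat :: "real mat \<Rightarrow> nat \<times> nat \<Rightarrow> real" where
  "array_of_mat A = (\<lambda>(i, j). if i < dim_row A \<and> j < dim_col A then A $$ (i, j) else 0)"

text \<open>The input consists of the size \<open>p\<close> in variable \<open>p\<close> and two \<open>p \<times> p\<close> matrices in arrays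
  \<open>A\<close> and \<open>C\<close>; the \<open>p \<times> p\<close> result is read off from array \<open>S\<close>.\<close>

definition input_state :: "nat \<Rightarrow> real mat \<Rightarrow> real mat \<Rightarrow> istore \<times> rstore" where
  "input_state p A C =
     ((\<lambda>_. 0)(''p'' := p),
      (\<lambda>_ _. 0)(''A'' := array_of_mat A, ''C'' := array_of_mat C))"

definition computes_within ::
    "com \<Rightarrow> nat \<Rightarrow> real mat \<Rightarrow> real mat \<Rightarrow> nat \<Rightarrow> real mat \<Rightarrow> bool" where
  "computes_within alg p A C T S \<longleftrightarrow>
     (\<exists>t s m. exec alg (input_state p A C) t (s, m) \<and> t \<le> T \<and> S = mat p p (m ''S''))"

end

theory Submission
  imports Defs
begin

text \<open>
  Write \<open>A\<close>, \<open>B\<close> for the first \<open>p\<close> and the last \<open>n - p\<close> rows of \<open>X\<close>, and \<open>D = C - A\<close>. Any reflexive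
  generalized inverse \<open>S\<close> of \<open>D\<close> (that is, \<open>D S D = D\<close> and \<open>S D S = S\<close>) works. Orthonormality of
  \<open>Q = X C\<^sup>-\<^sup>1\<close> gives \<open>C\<^sup>T C = A\<^sup>T A + B\<^sup>T B\<close>, so a vector on which \<open>C\<close> and \<open>A\<close> agree is killed
  by \<open>B\<close>. Hence \<open>B (1 - S D) = 0\<close>, and with this the matrix \<open>M\<^sup>T = E\<^sub>2 + B S (E\<^sub>1 - Q\<^sup>T)\<close>, where
  \<open>E\<^sub>1\<close> and \<open>E\<^sub>2\<close> select the first and last rows, satisfies \<open>M\<^sup>T X = 0\<close> and \<open>M\<^sup>T M = 1\<close>.

  To compute \<open>S\<close>, eliminate in the bordered matrix with blocks \<open>D, 1, 1, 0\<close>: for each row \<open>i\<close> of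
  the upper left block that is not yet zero, subtract the rank-one matrix that clears row \<open>i\<close> and the
  pivot column. Throughout, the blocks are \<open>D - D S D\<close>, \<open>1 - D S\<close>, \<open>1 - S D\<close>, \<open>- S\<close> for some \<open>S\<close>
  with \<open>S D S = S\<close>; when the upper left block vanishes, \<open>S\<close> is the inverse sought. There are at most
  \<open>p\<close> updates of \<open>O(p\<^sup>2)\<close> operations, and \<open>p\<close> pivot searches of \<open>O(p)\<close> comparisons.
\<close>

section \<open>Matrix identities under dimension side conditions\<close>

text \<open>The library versions of these laws have premises in \<^const>\<open>carrier_mat\<close> whose extra dimension
  variables the simplifier cannot instantiate for compound matrices.\<close>

lemma mat_assoc:
  fixes A :: "'a::semiring_0 mat"
  assumes "dim_col A = dim_row B" "dim_col B = dim_row C"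
  shows "A * B * C = A * (B * C)"
  by (rule assoc_mult_mat[of A "dim_row A" "dim_row B" B "dim_row C" C "dim_col C"])
     (rule carrier_matI; simp only: assms)+

lemma mat_add_mult:
  fixes A :: "'a::semiring_0 mat"
  assumes "dim_row A = dim_row B" "dim_col A = dim_row C" "dim_col B = dim_row C"
  shows "(A + B) * C = A * C + B * C"
  by (rule add_mult_distrib_mat[of A "dim_row A" "dim_row C" B C "dim_col C"])
     (rule carrier_matI; simp only: assms)+

lemma mat_mult_add:
  fixes A :: "'a::semiring_0 mat"
  assumes "dim_col A = dim_row B" "dim_row C = dim_row B" "dim_col C = dim_col B"
  shows "A * (B + C) = A * B + A * C"
  by (rule mult_add_distrib_mat[of A "dim_row A" "dim_row B" B "dim_col B" C])
     (rule carrier_matI; simp only: assms)+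

lemma mat_minus_mult:
  fixes A :: "'a::ring mat"
  assumes "dim_row A = dim_row B" "dim_col A = dim_row C" "dim_col B = dim_row C"
  shows "(A - B) * C = A * C - B * C"
  by (rule minus_mult_distrib_mat[of A "dim_row A" "dim_row C" B C "dim_col C"])
     (rule carrier_matI; simp only: assms)+

lemma mat_mult_minus:
  fixes A :: "'a::ring mat"
  assumes "dim_col A = dim_row B" "dim_row C = dim_row B" "dim_col C = dim_col B"
  shows "A * (B - C) = A * B - A * C"
  by (rule mult_minus_distrib_mat[of A "dim_row A" "dim_row B" B "dim_col B" C])
     (rule carrier_matI; simp only: assms)+

lemma mat_one_mult:
  fixes A :: "'a::semiring_1 mat"
  shows "dim_row A = n \<Longrightarrow> 1\<^sub>m n * A = A" "dim_col A = n \<Longrightarrow> A * 1\<^sub>m n = A"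
  using left_mult_one_mat[OF carrier_matI, of A n "dim_col A"]
    right_mult_one_mat[OF carrier_matI, of A "dim_row A" n] by blast+

lemma mat_zero_mult:
  fixes A :: "'a::semiring_0 mat"
  shows "dim_row A = n \<Longrightarrow> 0\<^sub>m k n * A = 0\<^sub>m k (dim_col A)"
    "dim_col A = n \<Longrightarrow> A * 0\<^sub>m n k = 0\<^sub>m (dim_row A) k"
  using left_mult_zero_mat[OF carrier_matI, of A n "dim_col A" k]
    right_mult_zero_mat[OF carrier_matI, of A "dim_row A" n k] by blast+

lemma mat_transpose_mult:
  fixes A :: "'a::comm_semiring_0 mat"
  assumes "dim_col A = dim_row B"
  shows "(A * B)\<^sup>T = B\<^sup>T * A\<^sup>T"
  by (rule transpose_mult[of A "dim_row A" "dim_row B" B "dim_col B"])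
     (rule carrier_matI; simp only: assms)+

lemma mat_transpose_add_minus:
  assumes "dim_row A = dim_row B" "dim_col A = dim_col B"
  shows "(A + B)\<^sup>T = A\<^sup>T + B\<^sup>T" "(A - B)\<^sup>T = A\<^sup>T - B\<^sup>T"
  using assms by (auto intro!: eq_matI)

lemmas mat_expand = mat_assoc mat_add_mult mat_mult_add mat_minus_mult mat_mult_minus mat_one_mult
  mat_zero_mult mat_transpose_mult mat_transpose_add_minus

text \<open>Each diagonal entry of \<open>A\<^sup>T * A\<close> is the sum of squares of a
  column.\<close>

lemma mat_transpose_mult_self_eq_0:
  fixes A :: "real mat"
  assumes "A\<^sup>T * A = 0\<^sub>m (dim_col A) (dim_col A)"
  shows "A = 0\<^sub>m (dim_row A) (dim_col A)"
proof (rule eq_matI)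
  fix i j
  assume ij: "i < dim_row (0\<^sub>m (dim_row A) (dim_col A))"
    "j < dim_col (0\<^sub>m (dim_row A) (dim_col A))"
  have "col A j \<bullet> col A j = (A\<^sup>T * A) $$ (j, j)" using ij by simp
  also have "\<dots> = 0" using ij by (simp add: assms del: index_mult_mat)
  finally have "(\<Sum>k\<in>{0..<dim_row A}. A $$ (k, j) * A $$ (k, j)) = 0"
    using ij by (simp add: scalar_prod_def)
  then have "A $$ (i, j) * A $$ (i, j) = 0"
    using ij by (subst (asm) sum_nonneg_eq_0_iff) auto
  then show "A $$ (i, j) = 0\<^sub>m (dim_row A) (dim_col A) $$ (i, j)"
    using ij by simp
qed simp_all

section \<open>Reflexive generalized inverses\<close>

text \<open>\<open>mat_inverse\<close> returns an option. A two-sided inverse \<open>B\<close> must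
  itself be \<open>p\<close> by \<open>p\<close>, which makes \<open>C\<close> a unit of the matrix
  ring, and for units the option is not \<open>None\<close>.\<close>

lemma invertible_mat_inverse:
  fixes C :: "'a::field mat"
  assumes "C \<in> carrier_mat p p" "invertible_mat C"
  shows "the (mat_inverse C) \<in> carrier_mat p p"
    "C * the (mat_inverse C) = 1\<^sub>m p" "the (mat_inverse C) * C = 1\<^sub>m p"
proof -
  obtain B where B: "inverts_mat C B" "inverts_mat B C"
    using assms(2) by (auto simp: invertible_mat_def)
  then have "B \<in> carrier_mat p p"
    using assms(1) unfolding inverts_mat_def
    by (metis carrier_matD(1) carrier_matD(2) carrier_matI index_mult_mat(3) index_one_mat(3) index_mult_mat(2))
  with B have "C \<in> Units (ring_mat TYPE('a) p ())"
    using assms(1) by (auto simp: Units_def ring_mat_simps inverts_mat_def intro!: exI[of _ B] bexI[of _ B])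
  then have "mat_inverse C \<noteq> None" using mat_inverse(1)[OF assms(1), of "()"] by blast
  then obtain B' where "mat_inverse C = Some B'" by auto
  then show "the (mat_inverse C) \<in> carrier_mat p p"
    "C * the (mat_inverse C) = 1\<^sub>m p" "the (mat_inverse C) * C = 1\<^sub>m p"
    using mat_inverse(2)[OF assms(1)] by auto
qed

lemma generalized_inverse_of_invertible:
  fixes D :: "'a::field mat"
  assumes D: "D \<in> carrier_mat p p" and S: "S \<in> carrier_mat p p"
    and DSD: "D * (S * D) = D" and inv: "invertible_mat D"
  shows "S = the (mat_inverse D)"
proof -
  note I = invertible_mat_inverse[OF D inv]
  let ?I = "the (mat_inverse D)"
  have d: "dim_row D = p" "dim_col D = p" "dim_row S = p" "dim_col S = p" 
    "dim_row ?I = p" "dim_col ?I = p"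
    using D S I by auto
  have IDX: "?I * (D * X) = X" if "dim_row X = p" for X
    using arg_cong[OF I(3), of "\<lambda>Y. Y * X"] that by (simp add: mat_assoc mat_one_mult d)
  have "?I * (D * (S * D)) * ?I = S"
    by (simp add: mat_assoc d IDX I mat_one_mult)
  moreover have "?I * (D * (S * D)) * ?I = ?I"
    unfolding DSD using I by simp
  ultimately show ?thesis by simp
qed

section \<open>Ranks of products and of generalized inverses\<close>

text \<open>Multiplication by \<open>A\<close> maps \<open>col_space B\<close> onto
  \<open>col_space (A * B)\<close>, and by rank-nullity a linear image has at most the dimension of
  its source.\<close>

lemma (in vec_space) rank_mult_le:
  assumes A: "A \<in> carrier_mat n n" and B: "B \<in> carrier_mat n n"
  shows "rank (A * B) \<le> rank B"
proof -
  let ?V = "vs (col_space B)"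
  have cB: "set (cols B) \<subseteq> carrier_vec n" using cols_dim[of B] carrier_matD(1)[OF B] by simp
  have sub: "VectorSpace.subspace class_ring (col_space B) V"
    unfolding col_space_def using span_is_subspace[OF cB] .
  interpret VB: vectorspace class_ring ?V using subspace_is_vs[OF sub] .
  have AB: "A * B \<in> carrier_mat n n" using A B by simp
  interpret T: linear_map class_ring ?V V "\<lambda>v. A *\<^sub>v v"
  proof unfold_locales
    show "(\<lambda>v. A *\<^sub>v v) \<in> LinearCombinations.module_hom class_ring ?V V"
      using A B by (auto simp: LinearCombinations.module_hom_def module_vec_simps col_space_eq[OF B]
        mult_add_distrib_mat_vec mult_mat_vec class_ring_simps)
  qed
  have im: "T.imT = col_space (A * B)"
    unfolding T.im_def
    using A B by (auto simp: col_space_eq[OF B] col_space_eq[OF AB] image_def)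
      (metis mult_mat_vec_carrier)
  have fd: "VB.fin_dim" unfolding col_space_def by (rule fin_dim_span) (use cB in auto)
  have "vectorspace.dim class_ring (vs (col_space (A * B))) \<le> VB.dim"
    using T.rank_nullity[OF fd] im by simp
  then show ?thesis unfolding rank_def col_space_def .
qed

text \<open>Because \<open>D x = D S (D x)\<close>, the column spaces of \<open>D\<close> and
  \<open>D * S\<close> agree, and the rank of \<open>D * S\<close> is at most that of
  \<open>S\<close>. For a reflexive inverse the roles of \<open>D\<close> and \<open>S\<close> can
  be exchanged, which gives equal ranks.\<close>

lemma (in vec_space) rank_generalized_inverse_le:
  assumes D: "D \<in> carrier_mat n n" and S: "S \<in> carrier_mat n n" and DSD: "D * (S * D) = D"
  shows "rank D \<le> rank S"
proof -
  have DS: "D * S \<in> carrier_mat n n" using D S by simp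
  have "col_space D = col_space (D * S)"
  proof (intro equalityI subsetI)
    fix y assume "y \<in> col_space D"
    then obtain x where x: "x \<in> carrier_vec n" "y = D *\<^sub>v x" using D by (auto simp: col_space_eq[OF D])
    then have "y = (D * S) *\<^sub>v (D *\<^sub>v x)"
      using arg_cong[OF DSD, of "\<lambda>Y. Y *\<^sub>v x"] x(2)
      by (simp add: assoc_mult_mat_vec[OF D mult_carrier_mat[OF S D] x(1)] assoc_mult_mat_vec[OF S D x(1)]
        assoc_mult_mat_vec[OF D S mult_mat_vec_carrier[OF D x(1)]])
    with x show "y \<in> col_space (D * S)" using D S by (auto simp: col_space_eq[OF DS])
  next
    fix y assume "y \<in> col_space (D * S)"
    then show "y \<in> col_space D" using D S by (auto simp: col_space_eq[OF D] col_space_eq[OF DS])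
  qed
  then have "rank D = rank (D * S)" unfolding rank_def col_space_def by simp
  with rank_mult_le[OF D S] show ?thesis by simp
qed

text \<open>\<open>R\<close>, \<open>N\<close>, \<open>Z\<close> and \<open>- S\<close> are the
  blocks of the bordered matrix; replacing \<open>S\<close> by \<open>S'\<close> subtracts from each
  block a product through \<open>G\<close>. In \<open>S' * (D * S')\<close> the mixed terms vanish
  by \<open>N * (D * S) = 0\<close> and \<open>S * (D * Z) = 0\<close>, and the last term is reduced
  by \<open>N * (D * Z) = R\<close> and \<open>G * (R * G) = G\<close>.\<close>

lemma pivot_update:
  fixes D S G :: "'a::ring_1 mat"
  assumes D: "D \<in> carrier_mat p p" and S: "S \<in> carrier_mat p p" and G: "G \<in> carrier_mat p p"
    and SDS: "S * (D * S) = S" and GRG: "G * ((D - D * (S * D)) * G) = G"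
  defines "R \<equiv> D - D * (S * D)" and "Z \<equiv> 1\<^sub>m p - S * D" and "N \<equiv> 1\<^sub>m p - D * S"
  defines "S' \<equiv> S + Z * (G * N)"
  shows "S' \<in> carrier_mat p p" "S' * (D * S') = S'"
    "D - D * (S' * D) = R - R * (G * R)"
    "1\<^sub>m p - D * S' = N - R * (G * N)"
    "1\<^sub>m p - S' * D = Z - Z * (G * R)"
proof -
  have d: "dim_row D = p" "dim_col D = p" "dim_row S = p" "dim_col S = p" "dim_row G = p" "dim_col G = p"
     using D S G by auto
  have dR: "dim_row R = p" "dim_col R = p" "dim_row Z = p" "dim_col Z = p" "dim_row N = p" "dim_col N = p"
    by (auto simp: R_def Z_def N_def d)
  \<comment> \<open>Products are normalized to the right, so a rule for an inner product is also
    stated with an arbitrary right factor \<open>X\<close>.\<close>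
  have SDSX: "S * (D * (S * X)) = S * X" if "dim_row X = p" for X
    using arg_cong[OF SDS, of "\<lambda>Y. Y * X"] that by (simp add: mat_assoc d)
  have DZ: "D * Z = R" and ND: "N * D = R"
    by (simp_all add: R_def Z_def N_def d mat_expand)
  have NDS: "N * (D * S) = 0\<^sub>m p p"
    by (rule eq_matI) (simp_all add: N_def d mat_expand SDS del: index_mult_mat(1))
  have SDZ: "S * (D * Z) = 0\<^sub>m p p"
    by (rule eq_matI) (simp_all add: Z_def d mat_expand SDSX del: index_mult_mat(1))
  have RZ: "R * Z = R"
    by (rule eq_matI) (simp_all add: R_def Z_def d mat_expand SDSX del: index_mult_mat(1))
  show "S' \<in> carrier_mat p p" by (rule carrier_matI) (simp_all add: S'_def d dR)
  have NDZX: "N * (D * (Z * X)) = R * X" if "dim_row X = p" for X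
    using arg_cong[OF RZ, of "\<lambda>Y. Y * X"] arg_cong[OF ND, of "\<lambda>Y. Y * (Z * X)"] that
    by (simp add: mat_assoc d dR)
  have SDZX: "S * (D * (Z * X)) = 0\<^sub>m p (dim_col X)" if "dim_row X = p" for X
  proof -
    have "S * (D * (Z * X)) = S * (D * Z) * X" by (simp add: mat_assoc d dR that)
    then show ?thesis using SDZ that by (simp add: mat_zero_mult)
  qed
  have GRGX: "G * (R * (G * X)) = G * X" if "dim_row X = p" for X
    using arg_cong[OF GRG[folded R_def], of "\<lambda>Y. Y * X"] that by (simp add: mat_assoc d dR)
  show "S' * (D * S') = S'"
    unfolding S'_def
    by (rule eq_matI)
      (simp_all add: d dR mat_add_mult mat_mult_add mat_assoc mat_zero_mult SDS NDS SDZX NDZX GRGX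
        del: index_mult_mat(1))
  have DZX: "D * (Z * X) = R * X" if "dim_row X = p" for X
    using arg_cong[OF DZ, of "\<lambda>Y. Y * X"] that by (simp add: mat_assoc d dR)
  show "D - D * (S' * D) = R - R * (G * R)"
    unfolding S'_def
    by (rule eq_matI)
     (simp_all add: d dR mat_add_mult mat_mult_add mat_assoc ND DZX del: index_mult_mat(1),
       simp add: R_def d del: index_mult_mat(1))
  show "1\<^sub>m p - D * S' = N - R * (G * N)"
    unfolding S'_def
    by (rule eq_matI)
     (simp_all add: d dR mat_mult_add DZX del: index_mult_mat(1),
       simp add: N_def d del: index_mult_mat(1))
  show "1\<^sub>m p - S' * D = Z - Z * (G * R)"
    unfolding S'_def
    by (rule eq_matI)
     (simp_all add: d dR mat_add_mult mat_assoc ND del: index_mult_mat(1),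
       simp add: Z_def d del: index_mult_mat(1))
qed

section \<open>Programs and their cost\<close>

text \<open>Total correctness with a bound on the cost. One run suffices as witness, since by
  \<open>exec_deterministic\<close> a start state admits no other.\<close>

definition runs :: "com \<Rightarrow> istore \<times> rstore \<Rightarrow> nat \<Rightarrow> (istore \<times> rstore \<Rightarrow> bool) \<Rightarrow> bool" where
  "runs c st T Q \<longleftrightarrow> (\<exists>t st'. exec c st t st' \<and> t \<le> T \<and> Q st')"

lemma runs_weaken:
  assumes "runs c st T Q" "T \<le> U" "\<And>st'. Q st' \<Longrightarrow> R st'"
  shows "runs c st U R"
  using assms unfolding runs_def by (blast intro: le_trans)

lemma runs_Skip: "Q st \<Longrightarrow> runs Skip st 0 Q"
  unfolding runs_def using exec_Skip by blast

lemma runs_IAssign: "Q (s(x := ival a s), m) \<Longrightarrow> runs (IAssign x a) (s, m) 0 Q"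
  unfolding runs_def using exec_IAssign by blast

lemma runs_RAssign:
  "rdefined e s m \<Longrightarrow> Q (s, m(v := (m v)((ival i s, ival j s) := rval e s m))) \<Longrightarrow>
    runs (RAssign v i j e) (s, m) (rcost e) Q"
  unfolding runs_def using exec_RAssign by blast

lemma runs_Seq:
  assumes "runs c st T Q" "\<And>st'. Q st' \<Longrightarrow> runs d st' U R"
  shows "runs (Seq c d) st (T + U) R"
  using assms unfolding runs_def by (meson add_mono exec_Seq)

lemma runs_Cond:
  assumes "bdefined b s m"
    and "bval b s m \<Longrightarrow> runs c (s, m) T Q" and "\<not> bval b s m \<Longrightarrow> runs d (s, m) T Q"
  shows "runs (Cond b c d) (s, m) (bcost b + T) Q"
  using assms unfolding runs_def by (meson add_left_mono exec_CondT exec_CondF)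

text \<open>The invariant is indexed by the number of completed rounds. The guard is evaluated once
  more than the body, hence the extra \<open>bcost b\<close>.\<close>

lemma runs_While:
  assumes step: "\<And>i s m. i < N \<Longrightarrow> P i (s, m) \<Longrightarrow>
      bdefined b s m \<and> bval b s m \<and> runs c (s, m) K (P (Suc i))"
    and stop: "\<And>s m. P N (s, m) \<Longrightarrow> bdefined b s m \<and> \<not> bval b s m"
    and init: "P 0 (s, m)"
  shows "runs (While b c) (s, m) (N * (bcost b + K) + bcost b) (P N)"
proof -
  have "runs (While b c) (s, m) (n * (bcost b + K) + bcost b) (P N)"
    if "P i (s, m)" "i + n = N" for n i s m
    using that
  proof (induction n arbitrary: i s m)
    case 0
    then show ?case
      using stop[of s m] unfolding runs_def by (auto intro!: exI exec_WhileF)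
  next
    case (Suc n)
    then have "bdefined b s m" "bval b s m" "runs c (s, m) K (P (Suc i))"
      using step[of i s m] by auto
    then obtain t s' m' where 1: "exec c (s, m) t (s', m')" "t \<le> K" "P (Suc i) (s', m')"
      unfolding runs_def by auto
    with Suc.IH[of "Suc i" s' m'] Suc.prems obtain u st'' where
      2: "exec (While b c) (s', m') u st''" "u \<le> n * (bcost b + K) + bcost b" "P N st''"
      unfolding runs_def by auto
    have "exec (While b c) (s, m) (bcost b + t + u) st''"
      by (rule exec_WhileT) fact+
    moreover have "bcost b + t + u \<le> Suc n * (bcost b + K) + bcost b" using 1 2 by simp
    ultimately show ?case using 2(3) unfolding runs_def by blast
  qed
  from this[of 0 s m N] init show ?thesis by simp
qed

section \<open>Counting loops and filling of arrays\<close>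

definition For :: "string \<Rightarrow> iexp \<Rightarrow> com \<Rightarrow> com" where
  "For x a c = Seq (IAssign x (INum 0))
     (While (ILess (IVar x) a) (Seq c (IAssign x (IAdd (IVar x) (INum 1)))))"

text \<open>The counter is tested and advanced without real operations, so only the bodies are
  charged. The bound \<open>a\<close> is evaluated anew in each round, so \<open>range\<close> lets
  the invariant fix its value.\<close>

lemma runs_For:
  assumes init: "P 0 (s(x := 0), m)"
    and range: "\<And>i s m. P i (s, m) \<Longrightarrow> s x = i \<and> ival a s = N"
    and body: "\<And>i s m. i < N \<Longrightarrow> P i (s, m) \<Longrightarrow>
      runs c (s, m) K (\<lambda>(s', m'). P (Suc i) (s'(x := s' x + 1), m'))"
  shows "runs (For x a c) (s, m) (N * K) (P N)"
proof -
  let ?b = "ILess (IVar x) a" and ?c = "Seq c (IAssign x (IAdd (IVar x) (INum 1)))"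
  have "runs (While ?b ?c) (s(x := 0), m) (N * (bcost ?b + K) + bcost ?b) (P N)"
  proof (rule runs_While)
    fix i s m assume i: "i < N" "P i (s, m)"
    have "runs ?c (s, m) (K + 0) (P (Suc i))"
      by (rule runs_Seq[OF body[OF i]]) (auto intro!: runs_IAssign)
    then show "bdefined ?b s m \<and> bval ?b s m \<and> runs ?c (s, m) K (P (Suc i))"
      using range[OF i(2)] i(1) by simp
  next
    fix s m assume "P N (s, m)"
    then show "bdefined ?b s m \<and> \<not> bval ?b s m" using range by fastforce
  qed (rule init)
  then have "runs (While ?b ?c) (s(x := 0), m) (N * K) (P N)" by simp
  then have "runs (For x a c) (s, m) (0 + N * K) (P N)"
    unfolding For_def
    by (intro runs_Seq[of _ _ _ "\<lambda>st. st = (s(x := 0), m)"] runs_IAssign) auto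
  then show ?thesis by simp
qed

definition Fill :: "string \<Rightarrow> iexp \<Rightarrow> rexp \<Rightarrow> com" where
  "Fill V a e = For ''k'' a (For ''l'' a (RAssign V (IVar ''k'') (IVar ''l'') e))"

text \<open>The assumption \<open>entry\<close> ranges over all contents \<open>g\<close> of the
  array \<open>V\<close>, so the values written cannot depend on entries already
  overwritten.\<close>

lemma runs_Fill:
  fixes f :: "nat \<Rightarrow> nat \<Rightarrow> real"
  assumes range: "\<And>x y. ival a (s(''k'' := x, ''l'' := y)) = N"
    and entry: "\<And>x y g. x < N \<Longrightarrow> y < N \<Longrightarrow>
      rdefined e (s(''k'' := x, ''l'' := y)) (m(V := g)) \<and>
      rval e (s(''k'' := x, ''l'' := y)) (m(V := g)) = f x y"
    and post: "\<And>x y. Q (s(''k'' := x, ''l'' := y),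
      m(V := (\<lambda>(x, y). if x < N \<and> y < N then f x y else m V (x, y))))"
  shows "runs (Fill V a e) (s, m) (N * (N * rcost e)) Q"
proof -
  \<comment> \<open>\<open>g x z\<close> is the array once the rows before \<open>x\<close> and the
    first \<open>z\<close> entries of row \<open>x\<close> are written.\<close>
  define g where "g x z = (\<lambda>(k, l). if k < N \<and> l < N \<and> (k < x \<or> k = x \<and> l < z) then f k l else m V (k, l))"
    for x z
  define I where "I x z st \<longleftrightarrow> st = (s(''k'' := x, ''l'' := z), m(V := g x z))" for x z st
  \<comment> \<open>The value of \<open>''l''\<close> stays open: it is the initial one before the
    first row and \<open>N\<close> after each row.\<close>
  define O' where "O' x st \<longleftrightarrow> (\<exists>y. st = (s(''k'' := x, ''l'' := y), m(V := g x 0)))" for x st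
  have g0: "g 0 0 = m V" by (auto simp: g_def)
  have gN: "g x N = g (Suc x) 0" for x by (auto simp: g_def fun_eq_iff)
  have gS: "(g x z)((x, z) := f x z) = g x (Suc z)" if "x < N" "z < N" for x z
    using that by (auto simp: g_def fun_eq_iff)
  have "runs (Fill V a e) (s, m) (N * (N * rcost e)) (O' N)"
    unfolding Fill_def
  proof (rule runs_For)
    have "s(''k'' := 0) = s(''k'' := 0, ''l'' := s ''l'')" by auto
    moreover have "m = m(V := g 0 0)" by (simp add: g0)
    ultimately show "O' 0 (s(''k'' := 0), m)" unfolding O'_def by metis
  next
    fix x s' m' assume "O' x (s', m')"
    then show "s' ''k'' = x \<and> ival a s' = N" by (auto simp: O'_def range)
  next
    fix x s' m' assume x: "x < N" and "O' x (s', m')"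
    then obtain y where st: "s' = s(''k'' := x, ''l'' := y)" "m' = m(V := g x 0)" by (auto simp: O'_def)
    have "runs (For ''l'' a (RAssign V (IVar ''k'') (IVar ''l'') e)) (s', m') (N * rcost e) (I x N)"
    proof (rule runs_For)
      show "I x 0 (s'(''l'' := 0), m')" by (auto simp: I_def st)
    next
      fix z s'' m'' assume "I x z (s'', m'')"
      then show "s'' ''l'' = z \<and> ival a s'' = N" by (auto simp: I_def range)
    next
      fix z s'' m'' assume z: "z < N" and "I x z (s'', m'')"
      then have st: "s'' = s(''k'' := x, ''l'' := z)" "m'' = m(V := g x z)" by (auto simp: I_def)
      show "runs (RAssign V (IVar ''k'') (IVar ''l'') e) (s'', m'') (rcost e)
          (\<lambda>(s', m'). I x (Suc z) (s'(''l'' := s' ''l'' + 1), m'))"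
        using entry[OF x z, of "g x z"]
        by (intro runs_RAssign) (auto simp: st I_def gS[OF x z])
    qed
    then show "runs (For ''l'' a (RAssign V (IVar ''k'') (IVar ''l'') e)) (s', m') (N * rcost e)
        (\<lambda>(s', m'). O' (Suc x) (s'(''k'' := s' ''k'' + 1), m'))"
    proof (rule runs_weaken)
      fix st' assume "I x N st'"
      then show "case st' of (s', m') \<Rightarrow> O' (Suc x) (s'(''k'' := s' ''k'' + 1), m')"
        by (auto simp: I_def O'_def gN intro!: exI[of _ N])
    qed simp
  qed
  then show ?thesis
  proof (rule runs_weaken)
    fix st' assume "O' N st'"
    moreover have "g N 0 = (\<lambda>(x, y). if x < N \<and> y < N then f x y else m V (x, y))"
      by (auto simp: g_def fun_eq_iff)
    ultimately show "Q st'" using post by (auto simp: O'_def)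
  qed simp
qed

section \<open>The elimination program\<close>

text \<open>For a nonzero pivot this subtracts a rank-one matrix, the outer product of column
  \<open>j\<close> and row \<open>i\<close>, scaled so that both that column and that row become
  zero.\<close>

definition pivoted :: "(nat \<times> nat \<Rightarrow> real) \<Rightarrow> nat \<Rightarrow> nat \<Rightarrow> nat \<Rightarrow> nat \<Rightarrow> real" where
  "pivoted w i j k l = w (k, l) - w (k, j) * w (i, l) / w (i, j)"

abbreviation "int_p \<equiv> IVar ''p''"
abbreviation "int_2p \<equiv> IMul (INum 2) int_p"

text \<open>In array \<open>E\<close> only the entry at the origin is nonzero, so the entry at the two truncated
  differences of \<open>a\<close> and \<open>b\<close> is 1 if \<open>a = b\<close> and 0 otherwise. The input arrays are zero outside
  their \<open>p \<times> p\<close> blocks.\<close>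

definition initialize :: com where
  "initialize = Seq (RAssign ''E'' (INum 0) (INum 0) (RNum 1))
     (Fill ''W'' int_2p
       (RAdd (RSub (RElem ''C'' (IVar ''k'') (IVar ''l'')) (RElem ''A'' (IVar ''k'') (IVar ''l'')))
         (RAdd (RElem ''E'' (ISub (IVar ''k'') (IAdd (IVar ''l'') int_p))
             (ISub (IAdd (IVar ''l'') int_p) (IVar ''k'')))
           (RElem ''E'' (ISub (IVar ''l'') (IAdd (IVar ''k'') int_p))
             (ISub (IAdd (IVar ''k'') int_p) (IVar ''l''))))))"

text \<open>Leaving the loop with \<open>''j''\<close> equal to \<open>p\<close> signals that the
  row is zero in its first \<open>p\<close> columns. As \<open>BAnd\<close> evaluates both
  conjuncts, that last test also reads and charges the entry in column \<open>p\<close>.\<close>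

definition find_pivot :: com where
  "find_pivot = Seq (IAssign ''j'' (INum 0))
     (While (BAnd (ILess (IVar ''j'') int_p) (REq (RElem ''W'' (IVar ''i'') (IVar ''j'')) (RNum 0)))
       (IAssign ''j'' (IAdd (IVar ''j'') (INum 1))))"

text \<open>The update needs the old pivot row and column throughout, so \<open>W\<close> is first
  copied to \<open>U\<close>.\<close>

definition pivot_step :: com where
  "pivot_step = Seq (Fill ''U'' int_2p (RElem ''W'' (IVar ''k'') (IVar ''l'')))
     (Fill ''W'' int_2p
       (RSub (RElem ''U'' (IVar ''k'') (IVar ''l''))
         (RDiv (RMul (RElem ''U'' (IVar ''k'') (IVar ''j'')) (RElem ''U'' (IVar ''i'') (IVar ''l'')))
           (RElem ''U'' (IVar ''i'') (IVar ''j'')))))"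

definition bordered_elimination :: com where
  "bordered_elimination = Seq initialize
     (Seq (For ''i'' int_p
         (Seq find_pivot (Cond (ILess (IVar ''j'') int_p) pivot_step Skip)))
       (Fill ''S'' int_p
         (RSub (RNum 0) (RElem ''W'' (IAdd int_p (IVar ''k'')) (IAdd int_p (IVar ''l''))))))"

text \<open>Stopping at column \<open>j\<close> costs \<open>j + 1\<close> comparisons, and
  \<open>j\<close> is at most \<open>p\<close>.\<close>

lemma runs_find_pivot:
  assumes p: "s ''p'' = p" and i: "s ''i'' = i"
    and post: "\<And>j. j \<le> p \<Longrightarrow> \<forall>l<j. m ''W'' (i, l) = 0 \<Longrightarrow> j < p \<longrightarrow> m ''W'' (i, j) \<noteq> 0 \<Longrightarrow>
      Q (s(''j'' := j), m)"
  shows "runs find_pivot (s, m) (p + 1) Q"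
proof -
  define j where "j = (LEAST j. j = p \<or> m ''W'' (i, j) \<noteq> 0)"
  have j: "j = p \<or> m ''W'' (i, j) \<noteq> 0" unfolding j_def by (rule LeastI[of _ p]) simp
  have jp: "j \<le> p" unfolding j_def by (rule Least_le) simp
  have below: "m ''W'' (i, l) = 0" if "l < j" for l
    using not_less_Least[OF that[unfolded j_def]] by simp
  let ?b = "BAnd (ILess (IVar ''j'') int_p) (REq (RElem ''W'' (IVar ''i'') (IVar ''j'')) (RNum 0))"
  have "runs (While ?b (IAssign ''j'' (IAdd (IVar ''j'') (INum 1)))) (s(''j'' := 0), m)
      (j * (bcost ?b + 0) + bcost ?b) (\<lambda>st. st = (s(''j'' := j), m))"
    by (rule runs_While) (use p i j jp below in \<open>auto intro!: runs_IAssign\<close>)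
  then have "runs find_pivot (s, m) (0 + (j * (bcost ?b + 0) + bcost ?b)) (\<lambda>st. st = (s(''j'' := j), m))"
    unfolding find_pivot_def
    by (intro runs_Seq[of _ _ _ "\<lambda>st. st = (s(''j'' := 0), m)"] runs_IAssign) auto
  then show ?thesis
    by (rule runs_weaken) (use jp j below post in auto)
qed

text \<open>The copy is free, and each of the \<open>2 * p * (2 * p)\<close> new entries takes one
  product, one division and one subtraction. The division is defined because the pivot is
  nonzero.\<close>

lemma runs_pivot_step:
  assumes p: "s ''p'' = p" and i: "s ''i'' = i" and j: "s ''j'' = j"
    and ij: "i < 2 * p" "j < 2 * p" "m ''W'' (i, j) \<noteq> 0"
    and post: "\<And>s' m'. s' ''p'' = p \<Longrightarrow> s' ''i'' = i \<Longrightarrow>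
      \<forall>k<2 * p. \<forall>l<2 * p. m' ''W'' (k, l) = pivoted (m ''W'') i j k l \<Longrightarrow> Q (s', m')"
  shows "runs pivot_step (s, m) (2 * p * (2 * p * 3)) Q"
proof -
  define Q1 where "Q1 = (\<lambda>(s', m'). s' ''p'' = p \<and> s' ''i'' = i \<and> s' ''j'' = j \<and>
    (\<forall>k<2 * p. \<forall>l<2 * p. m' ''U'' (k, l) = m ''W'' (k, l)))"
  have "runs pivot_step (s, m) (2 * p * (2 * p * 0) + 2 * p * (2 * p * 3)) Q"
    unfolding pivot_step_def
  proof (rule runs_Seq)
    have "runs (Fill ''U'' int_2p (RElem ''W'' (IVar ''k'') (IVar ''l''))) (s, m)
        (2 * p * (2 * p * rcost (RElem ''W'' (IVar ''k'') (IVar ''l'')))) Q1"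
      by (rule runs_Fill[where f = "\<lambda>x y. m ''W'' (x, y)"]) (use p i j in \<open>auto simp: Q1_def\<close>)
    then show "runs (Fill ''U'' int_2p (RElem ''W'' (IVar ''k'') (IVar ''l''))) (s, m)
        (2 * p * (2 * p * 0)) Q1" by simp
  next
    fix st' assume "Q1 st'"
    then obtain s' m' where st: "st' = (s', m')" "s' ''p'' = p" "s' ''i'' = i" "s' ''j'' = j"
      "\<And>k l. k < 2 * p \<Longrightarrow> l < 2 * p \<Longrightarrow> m' ''U'' (k, l) = m ''W'' (k, l)"
      by (cases st') (auto simp: Q1_def)
    let ?e = "RSub (RElem ''U'' (IVar ''k'') (IVar ''l''))
         (RDiv (RMul (RElem ''U'' (IVar ''k'') (IVar ''j'')) (RElem ''U'' (IVar ''i'') (IVar ''l'')))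
           (RElem ''U'' (IVar ''i'') (IVar ''j'')))"
    have "runs (Fill ''W'' int_2p ?e) (s', m') (2 * p * (2 * p * rcost ?e)) Q"
      by (rule runs_Fill[where f = "pivoted (m ''W'') i j"])
        (use ij in \<open>auto simp: st pivoted_def intro!: post\<close>)
    then show "runs (Fill ''W'' int_2p ?e) st' (2 * p * (2 * p * 3)) Q"
      by (simp add: st)
  qed
  then show ?thesis by simp
qed

lemma runs_initialize:
  assumes A: "A \<in> carrier_mat p p" and C: "C \<in> carrier_mat p p"
    and post: "\<And>s m. s ''p'' = p \<Longrightarrow> \<forall>k<2 * p. \<forall>l<2 * p. m ''W'' (k, l) =
       four_block_mat (C - A) (1\<^sub>m p) (1\<^sub>m p) (0\<^sub>m p p) $$ (k, l) \<Longrightarrow> Q (s, m)"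
  shows "runs initialize (input_state p A C) (2 * p * (2 * p * 3)) Q"
proof -
  let ?f = "\<lambda>k l. four_block_mat (C - A) (1\<^sub>m p) (1\<^sub>m p) (0\<^sub>m p p) $$ (k, l)"
  obtain s m where sm: "input_state p A C = (s, m)" by fastforce
  then have s: "s = (\<lambda>_. 0)(''p'' := p)"
    and m: "m = (\<lambda>_ _. 0)(''A'' := array_of_mat A, ''C'' := array_of_mat C)"
    by (auto simp: input_state_def)
  \<comment> \<open>Arrays other than the inputs start at zero, so a single assignment completes
    \<open>E\<close>.\<close>
  let ?m = "m(''E'' := (\<lambda>_. 0)((0, 0) := 1))"
  have "runs initialize (s, m) (0 + 2 * p * (2 * p * 3)) Q"
    unfolding initialize_def
  proof (rule runs_Seq[where Q = "\<lambda>st. st = (s, ?m)"])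
    show "runs (RAssign ''E'' (INum 0) (INum 0) (RNum 1)) (s, m) 0 (\<lambda>st. st = (s, ?m))"
      using runs_RAssign[of "RNum 1" s m "\<lambda>st. st = (s, ?m)" "''E''" "INum 0" "INum 0"] by (simp add: m)
  next
    let ?e = "RAdd (RSub (RElem ''C'' (IVar ''k'') (IVar ''l'')) (RElem ''A'' (IVar ''k'') (IVar ''l'')))
         (RAdd (RElem ''E'' (ISub (IVar ''k'') (IAdd (IVar ''l'') int_p))
             (ISub (IAdd (IVar ''l'') int_p) (IVar ''k'')))
           (RElem ''E'' (ISub (IVar ''l'') (IAdd (IVar ''k'') int_p))
             (ISub (IAdd (IVar ''k'') int_p) (IVar ''l''))))"
    fix st assume st: "st = (s, ?m)"
    have "runs (Fill ''W'' int_2p ?e) (s, ?m) (2 * p * (2 * p * rcost ?e)) Q"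
    proof (rule runs_Fill[where f = ?f])
      fix k l g assume "k < 2 * p" "l < 2 * p"
      then show "rdefined ?e (s(''k'' := k, ''l'' := l)) (?m(''W'' := g)) \<and>
        rval ?e (s(''k'' := k, ''l'' := l)) (?m(''W'' := g)) = ?f k l"
        using carrier_matD[OF A] carrier_matD[OF C] by (auto simp: s m array_of_mat_def)
    qed (auto simp: s intro!: post)
    then show "runs (Fill ''W'' int_2p ?e) st (2 * p * (2 * p * 3)) Q" by (simp add: st)
  qed
  then show ?thesis by (simp add: sm)
qed

section \<open>Bordered elimination\<close>

text \<open>A multiple of a matrix unit, at position \<open>(j, i)\<close> so that, with the
  reciprocal of a pivot at \<open>(i, j)\<close>, it inverts that entry.\<close>

definition unit_mat :: "nat \<Rightarrow> nat \<Rightarrow> nat \<Rightarrow> real \<Rightarrow> real mat" where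
  "unit_mat p j i c = mat p p (\<lambda>(a, b). if a = j \<and> b = i then c else 0)"

lemma unit_mat_dim [simp]: "dim_row (unit_mat p j i c) = p" "dim_col (unit_mat p j i c) = p"
  by (simp_all add: unit_mat_def)

lemma unit_mat_mult_index:
  assumes "dim_row B = p" "i < p" "a < p" "l < dim_col B"
  shows "(unit_mat p j i c * B) $$ (a, l) = (if a = j then c * B $$ (i, l) else 0)"
proof -
  have "(unit_mat p j i c * B) $$ (a, l) = (\<Sum>b\<in>{0..<p}. unit_mat p j i c $$ (a, b) * B $$ (b, l))"
    using assms by (simp add: scalar_prod_def)
  also have "\<dots> = (\<Sum>b\<in>{0..<p}. if b = i then (if a = j then c * B $$ (b, l) else 0) else 0)"
    using assms by (intro sum.cong) (auto simp: unit_mat_def)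
  also have "\<dots> = (if a = j then c * B $$ (i, l) else 0)"
    using assms by simp
  finally show ?thesis .
qed

text \<open>The product is \<open>c\<close> times the outer product of column \<open>j\<close> of
  \<open>A\<close> and row \<open>i\<close> of \<open>B\<close>, the form of the correction term in
  \<open>pivoted\<close>.\<close>

lemma mult_unit_mat_mult_index:
  assumes "dim_col A = p" "dim_row B = p" "i < p" "j < p" "k < dim_row A" "l < dim_col B"
  shows "(A * (unit_mat p j i c * B)) $$ (k, l) = A $$ (k, j) * c * B $$ (i, l)"
proof -
  have "(A * (unit_mat p j i c * B)) $$ (k, l) =
      (\<Sum>a\<in>{0..<p}. A $$ (k, a) * (unit_mat p j i c * B) $$ (a, l))"
    using assms by (simp add: index_mult_mat(1)[of k A l] scalar_prod_def[of "row A k"]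
      del: index_mult_mat(1))
  also have "\<dots> = (\<Sum>a\<in>{0..<p}. if a = j then A $$ (k, a) * c * B $$ (i, l) else 0)"
    using assms by (intro sum.cong) (auto simp: unit_mat_mult_index simp del: index_mult_mat(1))
  also have "\<dots> = A $$ (k, j) * c * B $$ (i, l)"
    using assms by simp
  finally show ?thesis .
qed

text \<open>With \<open>S = 0\<close> this is the initial matrix with blocks \<open>D\<close>, 1, 1,
  0, so the progress of the elimination is carried by \<open>S\<close> alone.\<close>

definition bordered :: "nat \<Rightarrow> real mat \<Rightarrow> real mat \<Rightarrow> real mat" where
  "bordered p D S = four_block_mat (D - D * (S * D)) (1\<^sub>m p - D * S) (1\<^sub>m p - S * D) (- S)"

definition elimination_inv :: "nat \<Rightarrow> real mat \<Rightarrow> nat \<Rightarrow> (nat \<times> nat \<Rightarrow> real) \<Rightarrow> bool" where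
  "elimination_inv p D i w \<longleftrightarrow> (\<exists>S \<in> carrier_mat p p. S * (D * S) = S \<and>
     (\<forall>k<2 * p. \<forall>l<2 * p. w (k, l) = bordered p D S $$ (k, l)) \<and>
     (\<forall>k<i. \<forall>l<p. w (k, l) = 0))"

lemma elimination_inv_init:
  assumes D: "D \<in> carrier_mat p p"
    and w: "\<forall>k<2 * p. \<forall>l<2 * p. w (k, l) = four_block_mat D (1\<^sub>m p) (1\<^sub>m p) (0\<^sub>m p p) $$ (k, l)"
  shows "elimination_inv p D 0 w"
proof -
  have "bordered p D (0\<^sub>m p p) = four_block_mat D (1\<^sub>m p) (1\<^sub>m p) (0\<^sub>m p p)"
    unfolding bordered_def
    by (rule cong_four_block_mat) (use D in auto)
  then show ?thesis
    unfolding elimination_inv_def using D w by (intro bexI[of _ "0\<^sub>m p p"]) auto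
qed

lemma elimination_inv_skip:
  assumes "elimination_inv p D i w" "\<forall>l<p. w (i, l) = 0"
  shows "elimination_inv p D (Suc i) w"
  using assms unfolding elimination_inv_def by (auto simp: less_Suc_eq)

text \<open>The matrix \<open>G\<close> with the reciprocal of the pivot at \<open>(j, i)\<close>
  satisfies \<open>G * (R * G) = G\<close>, since only the entry of \<open>R\<close> at
  \<open>(i, j)\<close> enters that product. Then \<open>pivot_update\<close> describes the same
  change as \<open>pivoted\<close>, block by block.\<close>

lemma elimination_inv_pivot:
  assumes D: "D \<in> carrier_mat p p" and inv: "elimination_inv p D i w"
    and i: "i < p" and j: "j < p" and piv: "w (i, j) \<noteq> 0"
    and w': "\<forall>k<2 * p. \<forall>l<2 * p. w' (k, l) = pivoted w i j k l"
  shows "elimination_inv p D (Suc i) w'"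
proof -
  obtain S where S: "S \<in> carrier_mat p p" "S * (D * S) = S"
    and w: "\<And>k l. k < 2 * p \<Longrightarrow> l < 2 * p \<Longrightarrow> w (k, l) = bordered p D S $$ (k, l)"
    and zero: "\<And>k l. k < i \<Longrightarrow> l < p \<Longrightarrow> w (k, l) = 0"
    using inv unfolding elimination_inv_def by blast
  define R where "R = D - D * (S * D)"
  define Z where "Z = 1\<^sub>m p - S * D"
  define N where "N = 1\<^sub>m p - D * S"
  define G where "G = unit_mat p j i (1 / w (i, j))"
  note d = carrier_matD[OF D] carrier_matD[OF S(1)]
  have dR: "dim_row R = p" "dim_col R = p" "dim_row Z = p" "dim_col Z = p"
    "dim_row N = p" "dim_col N = p" "dim_row G = p" "dim_col G = p"
    by (simp_all add: R_def Z_def N_def G_def d)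
  have wR: "w (k, l) = (if k < p then if l < p then R $$ (k, l) else N $$ (k, l - p)
      else if l < p then Z $$ (k - p, l) else - S $$ (k - p, l - p))" if "k < 2 * p" "l < 2 * p" for k l
    using that unfolding w[OF that] bordered_def R_def[symmetric] Z_def[symmetric] N_def[symmetric]
    by (simp add: dR d)
  have Rij: "R $$ (i, j) = w (i, j)" using i j by (simp add: wR)
  have GRG: "G * (R * G) = G"
  proof (rule eq_matI)
    fix a b assume "a < dim_row G" "b < dim_col G"
    then have ab: "a < p" "b < p" by (simp_all add: dR)
    have "(R * G) $$ (i, b) = (R * (G * 1\<^sub>m p)) $$ (i, b)" by (simp add: mat_one_mult dR)
    also have "\<dots> = (if b = i then 1 else 0)"
      unfolding G_def using ab i j piv
      by (subst mult_unit_mat_mult_index) (simp_all add: dR Rij)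
    finally have RG: "(R * G) $$ (i, b) = (if b = i then 1 else 0)" .
    have "(G * (R * G)) $$ (a, b) = (if a = j then 1 / w (i, j) * (R * G) $$ (i, b) else 0)"
      using unit_mat_mult_index[of "R * G" p i a b j "1 / w (i, j)"] ab i
      by (simp add: dR G_def[symmetric] del: index_mult_mat(1))
    then show "(G * (R * G)) $$ (a, b) = G $$ (a, b)"
      unfolding RG using ab by (simp add: G_def unit_mat_def)
  qed (simp_all add: dR)
  have entry: "(P * (G * Q)) $$ (k, l) = P $$ (k, j) * Q $$ (i, l) / w (i, j)"
    if "dim_row P = p" "dim_col P = p" "dim_row Q = p" "dim_col Q = p" "k < p" "l < p" for P Q k l
    unfolding G_def using that i j by (subst mult_unit_mat_mult_index) simp_all
  define S' where "S' = S + Z * (G * N)"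
  have G: "G \<in> carrier_mat p p" by (rule carrier_matI) (simp_all add: dR)
  note upd = pivot_update[OF D S(1) G S(2) GRG[unfolded R_def],
      folded R_def Z_def N_def, folded S'_def]
  have "w' (k, l) = bordered p D S' $$ (k, l)" if kl: "k < 2 * p" "l < 2 * p" for k l
  proof -
    have "bordered p D S' $$ (k, l) =
        (if k < p then if l < p then (R - R * (G * R)) $$ (k, l) else (N - R * (G * N)) $$ (k, l - p)
         else if l < p then (Z - Z * (G * R)) $$ (k - p, l) else - (S + Z * (G * N)) $$ (k - p, l - p))"
      using kl unfolding bordered_def upd
      by (simp add: S'_def dR d del: index_mult_mat(1))
    also have "\<dots> = w (k, l) - w (k, j) * w (i, l) / w (i, j)"
      using kl i j
      by (simp add: entry dR d wR[of k l] wR[of k j] wR[of i l] del: index_mult_mat(1))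
    finally show ?thesis using w' kl by (simp add: pivoted_def)
  qed
  \<comment> \<open>Row \<open>i\<close> cancels against itself; an earlier row has 0 in the pivot
    column and so stays zero.\<close>
  moreover have "w' (k, l) = 0" if "k < Suc i" "l < p" for k l
    using that i w' piv zero[of k l] zero[of k j] j by (auto simp: pivoted_def less_Suc_eq)
  ultimately show ?thesis
    unfolding elimination_inv_def using upd(1,2) by (intro bexI[of _ S']) blast+
qed

text \<open>After \<open>p\<close> rows the upper left block \<open>D - D * (S * D)\<close> is zero,
  and the lower right block is \<open>- S\<close>.\<close>

lemma elimination_inv_final:
  assumes D: "D \<in> carrier_mat p p" and inv: "elimination_inv p D p w"
  defines "S \<equiv> mat p p (\<lambda>(k, l). - w (p + k, p + l))"
  shows "D * (S * D) = D" "S * (D * S) = S"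
proof -
  obtain S' where S': "S' \<in> carrier_mat p p" "S' * (D * S') = S'"
    and w: "\<And>k l. k < 2 * p \<Longrightarrow> l < 2 * p \<Longrightarrow> w (k, l) = bordered p D S' $$ (k, l)"
    and zero: "\<And>k l. k < p \<Longrightarrow> l < p \<Longrightarrow> w (k, l) = 0"
    using inv unfolding elimination_inv_def by blast
  note d = carrier_matD[OF D] carrier_matD[OF S'(1)]
  have "S = S'"
    by (rule eq_matI) (simp_all add: S_def w bordered_def d)
  then show "S * (D * S) = S" using S' by simp
  show "D * (S * D) = D"
  proof (rule eq_matI)
    fix k l assume "k < dim_row D" "l < dim_col D"
    then have kl: "k < p" "l < p" by (simp_all add: d)
    then have "bordered p D S' $$ (k, l) = 0" using zero[OF kl] w[of k l] by simp
    then show "(D * (S * D)) $$ (k, l) = D $$ (k, l)"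
      unfolding \<open>S = S'\<close> using kl by (simp add: bordered_def d del: index_mult_mat(1))
  qed (simp_all add: S_def d)
qed

text \<open>Initialization takes \<open>12 * p^2\<close> operations, each of the \<open>p\<close>
  rounds at most \<open>p + 1\<close> comparisons and an update of \<open>12 * p^2\<close>, and the
  output \<open>p^2\<close> subtractions from 0.\<close>

lemma runs_bordered_elimination:
  assumes A: "A \<in> carrier_mat p p" and C: "C \<in> carrier_mat p p"
  shows "runs bordered_elimination (input_state p A C) (27 * p ^ 3)
    (\<lambda>(s, m). (C - A) * (mat p p (m ''S'') * (C - A)) = C - A \<and>
      mat p p (m ''S'') * ((C - A) * mat p p (m ''S'')) = mat p p (m ''S''))"
    (is "runs _ _ _ ?Q")
proof -
  let ?D = "C - A"
  have D: "?D \<in> carrier_mat p p" using A by (rule minus_carrier_mat)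
  define P where "P = (\<lambda>i (s, m). s ''p'' = p \<and> s ''i'' = i \<and> elimination_inv p ?D i (m ''W''))"
  let ?body = "Seq find_pivot (Cond (ILess (IVar ''j'') int_p) pivot_step Skip)"
  have body: "runs ?body (s, m) (p + 1 + 12 * p\<^sup>2) (\<lambda>(s', m'). P (Suc i) (s'(''i'' := s' ''i'' + 1), m'))"
    if i: "i < p" and P: "P i (s, m)" for i s m
  proof (rule runs_Seq)
    let ?I = "\<lambda>st. \<exists>j \<le> p. st = (s(''j'' := j), m) \<and> (\<forall>l<j. m ''W'' (i, l) = 0) \<and>
      (j < p \<longrightarrow> m ''W'' (i, j) \<noteq> 0)"
    show "runs find_pivot (s, m) (p + 1) ?I"
      by (rule runs_find_pivot[where i = i]) (use P in \<open>auto simp: P_def\<close>)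
    fix st assume "?I st"
    then obtain j where j: "j \<le> p" "st = (s(''j'' := j), m)" "\<forall>l<j. m ''W'' (i, l) = 0"
      "j < p \<Longrightarrow> m ''W'' (i, j) \<noteq> 0" by blast
    let ?R = "\<lambda>(s', m'). P (Suc i) (s'(''i'' := s' ''i'' + 1), m')"
    have "runs (Cond (ILess (IVar ''j'') int_p) pivot_step Skip) (s(''j'' := j), m)
        (bcost (ILess (IVar ''j'') int_p) + 2 * p * (2 * p * 3)) ?R"
    proof (rule runs_Cond)
      assume "bval (ILess (IVar ''j'') int_p) (s(''j'' := j)) m"
      then have "j < p" using P by (simp add: P_def)
      then show "runs pivot_step (s(''j'' := j), m) (2 * p * (2 * p * 3)) ?R"
        using P i j elimination_inv_pivot[OF D _ i]
        by (intro runs_pivot_step[where i = i and j = j]) (auto simp: P_def)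
    next
      assume "\<not> bval (ILess (IVar ''j'') int_p) (s(''j'' := j)) m"
      then have "j = p" using P j(1) by (simp add: P_def)
      then have "runs Skip (s(''j'' := j), m) 0 ?R"
        using P j(3) elimination_inv_skip by (intro runs_Skip) (auto simp: P_def)
      then show "runs Skip (s(''j'' := j), m) (2 * p * (2 * p * 3)) ?R"
        by (rule runs_weaken) auto
    qed simp
    then show "runs (Cond (ILess (IVar ''j'') int_p) pivot_step Skip) st (12 * p\<^sup>2) ?R"
      by (simp add: j(2) power2_eq_square mult.assoc)
  qed
  let ?out = "RSub (RNum 0) (RElem ''W'' (IAdd int_p (IVar ''k'')) (IAdd int_p (IVar ''l'')))"
  have "runs bordered_elimination (input_state p A C)
      (2 * p * (2 * p * 3) + (p * (p + 1 + 12 * p\<^sup>2) + p * (p * rcost ?out))) ?Q"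
    unfolding bordered_elimination_def
  proof (rule runs_Seq)
    show "runs initialize (input_state p A C) (2 * p * (2 * p * 3))
        (\<lambda>(s, m). s ''p'' = p \<and> elimination_inv p ?D 0 (m ''W''))"
      using elimination_inv_init[OF D] by (intro runs_initialize[OF A C]) auto
  next
    fix st assume st: "(\<lambda>(s, m). s ''p'' = p \<and> elimination_inv p ?D 0 (m ''W'')) st"
    show "runs (Seq (For ''i'' int_p ?body) (Fill ''S'' int_p ?out)) st
      (p * (p + 1 + 12 * p\<^sup>2) + p * (p * rcost ?out)) ?Q"
    proof (rule runs_Seq)
      obtain s m where sm: "st = (s, m)" by fastforce
      show "runs (For ''i'' int_p ?body) st (p * (p + 1 + 12 * p\<^sup>2)) (P p)"
        unfolding sm
        by (rule runs_For) (use st sm body in \<open>auto simp: P_def\<close>)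
    next
      fix st assume "P p st"
      then obtain s m where st: "st = (s, m)" "s ''p'' = p" "elimination_inv p ?D p (m ''W'')"
        by (cases st) (auto simp: P_def)
      let ?S = "\<lambda>(x, y). if x < p \<and> y < p then - m ''W'' (p + x, p + y) else m ''S'' (x, y)"
      have S: "mat p p ?S = mat p p (\<lambda>(k, l). - m ''W'' (p + k, p + l))"
        by (rule eq_matI) auto
      show "runs (Fill ''S'' int_p ?out) st (p * (p * rcost ?out)) ?Q"
        unfolding st(1)
        by (rule runs_Fill[where f = "\<lambda>k l. - m ''W'' (p + k, p + l)"])
          (use st(2) elimination_inv_final[OF D st(3)] in \<open>simp_all add: S\<close>)
    qed
  qed
  then show ?thesis
  proof (rule runs_weaken)
    \<comment> \<open>Monotonicity of powers needs a base of at least 1, hence the case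
      \<open>p = 0\<close>. The constant 27 is the sum of the coefficients 14, 1 and 12
      below.\<close>
    have "p \<le> p ^ 3" by (cases "p = 0") (auto intro: self_le_power)
    moreover have "p\<^sup>2 \<le> p ^ 3" by (cases "p = 0") (auto intro: power_increasing)
    moreover have "2 * p * (2 * p * 3) + (p * (p + 1 + 12 * p\<^sup>2) + p * (p * rcost ?out)) =
        14 * p\<^sup>2 + p + 12 * p ^ 3"
      by (simp add: algebra_simps power2_eq_square power3_eq_cube)
    ultimately show "2 * p * (2 * p * 3) + (p * (p + 1 + 12 * p\<^sup>2) + p * (p * rcost ?out)) \<le> 27 * p ^ 3"
      by linarith
  qed
qed

section \<open>The orthonormal basis of the complement\<close>

lemma orthonormal_cols_iff: "orthonormal_cols A \<longleftrightarrow> A\<^sup>T * A = 1\<^sub>m (dim_col A)"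
proof
  show "A\<^sup>T * A = 1\<^sub>m (dim_col A)" if "orthonormal_cols A"
    using that by (intro eq_matI) (auto simp: orthonormal_cols_def)
next
  assume *: "A\<^sup>T * A = 1\<^sub>m (dim_col A)"
  have "col A i \<bullet> col A j = (if i = j then 1 else 0)" if "i < dim_col A" "j < dim_col A" for i j
  proof -
    have "(A\<^sup>T * A) $$ (i, j) = col A i \<bullet> col A j" using that by simp
    then show ?thesis using that unfolding * by simp
  qed
  then show "orthonormal_cols A" by (simp add: orthonormal_cols_def)
qed

section \<open>Row selection as matrix multiplication\<close>

lemma row_first_rows_one: "i < p \<Longrightarrow> p \<le> n \<Longrightarrow> row (first_rows p (1\<^sub>m n)) i = unit_vec n i"
  by (intro eq_vecI) (auto simp: first_rows_def)

lemma row_last_rows_one: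
  "i < k \<Longrightarrow> k \<le> n \<Longrightarrow> row (last_rows k (1\<^sub>m n)) i = unit_vec n (n - k + i)"
  by (intro eq_vecI) (auto simp: last_rows_def)

text \<open>With row selection written as a factor, block computations reduce to the ring laws for
  matrices.\<close>

lemma first_rows_eq_mult:
  assumes "A \<in> carrier_mat n q" "p \<le> n"
  shows "first_rows p A = first_rows p (1\<^sub>m n) * A"
proof (rule eq_matI)
  note d = carrier_matD[OF assms(1)]
  fix i j assume "i < dim_row (first_rows p (1\<^sub>m n) * A)" "j < dim_col (first_rows p (1\<^sub>m n) * A)"
  then have ij: "i < p" "j < q" by (simp_all add: first_rows_def d)
  have "row (first_rows p (1\<^sub>m n)) i = unit_vec n i"
    using ij assms(2) by (simp add: row_first_rows_one)
  moreover have "col A j \<in> carrier_vec n" by (rule carrier_vecI) (simp add: d)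
  ultimately show "first_rows p A $$ (i, j) = (first_rows p (1\<^sub>m n) * A) $$ (i, j)"
    using ij assms(2) scalar_prod_left_unit[of "col A j" n i] by (simp add: first_rows_def d)
qed (use assms in \<open>simp_all add: first_rows_def\<close>)

lemma last_rows_eq_mult:
  assumes "A \<in> carrier_mat n q" "k \<le> n"
  shows "last_rows k A = last_rows k (1\<^sub>m n) * A"
proof (rule eq_matI)
  note d = carrier_matD[OF assms(1)]
  fix i j assume "i < dim_row (last_rows k (1\<^sub>m n) * A)" "j < dim_col (last_rows k (1\<^sub>m n) * A)"
  then have ij: "i < k" "j < q" by (simp_all add: last_rows_def d)
  have "row (last_rows k (1\<^sub>m n)) i = unit_vec n (n - k + i)"
    using ij assms(2) by (simp add: row_last_rows_one)
  moreover have "col A j \<in> carrier_vec n" by (rule carrier_vecI) (simp add: d)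
  ultimately show "last_rows k A $$ (i, j) = (last_rows k (1\<^sub>m n) * A) $$ (i, j)"
    using ij assms(2) scalar_prod_left_unit[of "col A j" n "n - k + i"] by (simp add: last_rows_def d)
qed (use assms in \<open>simp_all add: last_rows_def\<close>)

lemma vec_first_eq_mult:
  fixes x :: "real vec"
  assumes "x \<in> carrier_vec n" "p \<le> n"
  shows "vec_first x p = first_rows p (1\<^sub>m n) *\<^sub>v x"
proof (rule eq_vecI)
  fix i assume "i < dim_vec (first_rows p (1\<^sub>m n) *\<^sub>v x)"
  then have i: "i < p" by (simp add: first_rows_def)
  have "row (first_rows p (1\<^sub>m n)) i = unit_vec n i"
    using i assms(2) by (simp add: row_first_rows_one)
  then show "vec_first x p $ i = (first_rows p (1\<^sub>m n) *\<^sub>v x) $ i"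
    using i assms scalar_prod_left_unit[of x n i] by (simp add: first_rows_def vec_first_def)
qed (simp add: first_rows_def)

lemma vec_last_eq_mult:
  fixes x :: "real vec"
  assumes "x \<in> carrier_vec n" "k \<le> n"
  shows "vec_last x k = last_rows k (1\<^sub>m n) *\<^sub>v x"
proof (rule eq_vecI)
  fix i assume "i < dim_vec (last_rows k (1\<^sub>m n) *\<^sub>v x)"
  then have i: "i < k" by (simp add: last_rows_def)
  have "row (last_rows k (1\<^sub>m n)) i = unit_vec n (n - k + i)"
    using i assms(2) by (simp add: row_last_rows_one)
  then show "vec_last x k $ i = (last_rows k (1\<^sub>m n) *\<^sub>v x) $ i"
    using i assms scalar_prod_left_unit[of x n "n - k + i"] by (simp add: last_rows_def vec_last_def)
qed (simp add: last_rows_def)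

text \<open>\<open>E1\<close> stacked on \<open>E2\<close> is the identity matrix; the five
  relations are its orthogonality, block by block.\<close>

lemma row_partition:
  assumes "p \<le> n"
  defines "E1 \<equiv> first_rows p (1\<^sub>m n)" and "E2 \<equiv> last_rows (n - p) (1\<^sub>m n)"
  shows "E1 * E1\<^sup>T = 1\<^sub>m p" "E2 * E2\<^sup>T = 1\<^sub>m (n - p)"
    "E1 * E2\<^sup>T = 0\<^sub>m p (n - p)" "E2 * E1\<^sup>T = 0\<^sub>m (n - p) p" "E1\<^sup>T * E1 + E2\<^sup>T * E2 = 1\<^sub>m n"
proof -
  have row1: "row E1 i = unit_vec n i" if "i < p" for i
    using that assms(1) by (simp add: E1_def row_first_rows_one)
  have row2: "row E2 i = unit_vec n (p + i)" if "i < n - p" for i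
    using that assms(1) by (simp add: E2_def row_last_rows_one)
  have d: "dim_row E1 = p" "dim_col E1 = n" "dim_row E2 = n - p" "dim_col E2 = n"
    by (simp_all add: E1_def E2_def first_rows_def last_rows_def)
  show "E1 * E1\<^sup>T = 1\<^sub>m p" "E2 * E2\<^sup>T = 1\<^sub>m (n - p)"
    "E1 * E2\<^sup>T = 0\<^sub>m p (n - p)" "E2 * E1\<^sup>T = 0\<^sub>m (n - p) p"
    using assms(1) by (auto intro!: eq_matI simp: d row1 row2)
  show "E1\<^sup>T * E1 + E2\<^sup>T * E2 = 1\<^sub>m n"
  proof (rule eq_matI)
    fix i j assume "i < dim_row (1\<^sub>m n)" "j < dim_col (1\<^sub>m n)"
    then have ij: "i < n" "j < n" by simp_all
    have "(E1\<^sup>T * E1) $$ (i, j) = (\<Sum>k\<in>{0..<p}. (if k = i then 1 else 0) * (if k = j then 1 else 0))"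
      using ij assms(1) by (simp add: scalar_prod_def d) (auto intro!: sum.cong simp: E1_def first_rows_def)
    also have "\<dots> = (\<Sum>k\<in>{0..<p}. if k = i then (if i = j then 1 else 0) else 0)"
      by (intro sum.cong) auto
    finally have 1: "(E1\<^sup>T * E1) $$ (i, j) = (if i < p \<and> i = j then 1 else 0)" by simp
    have "(E2\<^sup>T * E2) $$ (i, j) =
        (\<Sum>k\<in>{0..<n - p}. (if p + k = i then 1 else 0) * (if p + k = j then 1 else 0))"
      using ij assms(1) by (simp add: scalar_prod_def d) (auto intro!: sum.cong simp: E2_def last_rows_def)
    \<comment> \<open>For \<open>i < p\<close> the truncated difference \<open>i - p\<close> is 0;
      the inner condition \<open>p \<le> i\<close> removes that term.\<close>
    also have "\<dots> = (\<Sum>k\<in>{0..<n - p}. if k = i - p then (if p \<le> i \<and> i = j then 1 else 0) else 0)"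
      by (intro sum.cong) auto
    finally have 2: "(E2\<^sup>T * E2) $$ (i, j) = (if p \<le> i \<and> i = j then 1 else 0)" using ij by auto
    have "(E1\<^sup>T * E1 + E2\<^sup>T * E2) $$ (i, j) = (E1\<^sup>T * E1) $$ (i, j) + (E2\<^sup>T * E2) $$ (i, j)"
      using ij by (simp add: d del: index_mult_mat(1))
    then show "(E1\<^sup>T * E1 + E2\<^sup>T * E2) $$ (i, j) = 1\<^sub>m n $$ (i, j)"
      unfolding 1 2 using ij by auto
  qed (simp_all add: d)
qed

section \<open>Orthogonal complements and orthonormal bases\<close>

text \<open>Orthogonality to the columns gives orthogonality to their span, and the entries of
  \<open>X\<^sup>T *\<^sub>v x\<close> are the inner products with the columns.\<close>

lemma (in vec_space) orthogonal_complement_col_space: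
  assumes X: "X \<in> carrier_mat n q"
  shows "orthogonal_complement (col_space X) = {x \<in> carrier_vec n. X\<^sup>T *\<^sub>v x = 0\<^sub>v q}"
proof -
  have "set (cols X) \<subseteq> carrier_vec n" using cols_dim[of X] carrier_matD(1)[OF X] by simp
  then have *: "orthogonal_complement (col_space X) = orthogonal_complement (set (cols X))"
    unfolding col_space_def by simp
  have "(\<forall>y\<in>set (cols X). x \<bullet> y = 0) \<longleftrightarrow> X\<^sup>T *\<^sub>v x = 0\<^sub>v q" if x: "x \<in> carrier_vec n" for x
  proof -
    have "x \<bullet> col X j = (X\<^sup>T *\<^sub>v x) $ j" if "j < q" for j
      using that X x by (auto simp: comm_scalar_prod[of x n])
    then have "(\<forall>j<q. x \<bullet> col X j = 0) \<longleftrightarrow> X\<^sup>T *\<^sub>v x = 0\<^sub>v q"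
      using X by (auto simp: vec_eq_iff)
    moreover have "set (cols X) = col X ` {..<q}"
      using X by (auto simp: cols_def)
    ultimately show ?thesis by auto
  qed
  then show ?thesis unfolding * unfolding orthogonal_complement_def by (simp cong: conj_cong)
qed

text \<open>If \<open>M v = 0\<close>, then \<open>v = M\<^sup>T (M v) = 0\<close>. A basis is a
  set, so distinctness of the columns is used to turn a dependence of that set into a coefficient
  vector \<open>v\<close>.\<close>

lemma cols_orthonormal_basis_col_space:
  assumes M: "M \<in> carrier_mat n k" and MM: "M\<^sup>T * M = 1\<^sub>m k"
  shows "cols_orthonormal_basis n M (vec_space.col_space n M)"
proof -
  interpret vec_space "TYPE(real)" n .
  have orth: "orthonormal_cols M" using M MM by (simp add: orthonormal_cols_iff)
  have cM: "set (cols M) \<subseteq> carrier_vec n" using cols_dim[of M] carrier_matD(1)[OF M] by simp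
  have dist: "distinct (cols M)"
    unfolding distinct_conv_nth
  proof (intro allI impI notI)
    fix i j assume ij: "i < length (cols M)" "j < length (cols M)" "i \<noteq> j" "cols M ! i = cols M ! j"
    then have "col M i = col M j" by simp
    moreover have "col M i \<bullet> col M i = 1" "col M i \<bullet> col M j = 0"
      using orth[unfolded orthonormal_cols_def, rule_format, of i i]
        orth[unfolded orthonormal_cols_def, rule_format, of i j] ij(1-3) by simp_all
    ultimately show False by simp
  qed
  have li: "lin_indpt (set (cols M))"
  proof (rule ccontr)
    assume "\<not> lin_indpt (set (cols M))"
    then obtain v where v: "v \<in> carrier_vec k" "v \<noteq> 0\<^sub>v k" "M *\<^sub>v v = 0\<^sub>v n"
      using lin_depE[OF M _ dist] by blast
    have "v = (M\<^sup>T * M) *\<^sub>v v" using v MM by simp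
    also have "\<dots> = M\<^sup>T *\<^sub>v (M *\<^sub>v v)"
      by (rule assoc_mult_mat_vec[of _ k n _ k]) (use M v in auto)
    also have "\<dots> = 0\<^sub>v k" unfolding v(3) using M by auto
    finally show False using v(2) by simp
  qed
  have sub: "submodule class_ring (span (set (cols M))) V"
    using span_is_submodule[of "set (cols M)"] cM by simp
  \<comment> \<open>Independence in the full space is carried over to the span regarded as a space
    of its own.\<close>
  have "set (cols M) \<subseteq> span (set (cols M))" using in_own_span[of "set (cols M)"] cM by simp
  note nd = span_li_not_depend[OF this sub]
  have vsp: "vectorspace class_ring (vs (span (set (cols M))))"
    using span_is_subspace[of "set (cols M)"] cM subspace_is_vs by simp
  have "vectorspace.basis class_ring (vs (span (set (cols M)))) (set (cols M))"
    unfolding vectorspace.basis_def[OF vsp] nd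
    using li \<open>set (cols M) \<subseteq> span (set (cols M))\<close> by simp
  then show ?thesis using orth unfolding cols_orthonormal_basis_def col_space_def by simp
qed

section \<open>Construction of the basis matrix\<close>

text \<open>\<open>M\<close> is the transpose of \<open>F\<close>, which annihilates
  \<open>X\<close> and has orthonormal rows. On the complement of the column space
  \<open>Q\<^sup>T x = 0\<close>, and what remains of \<open>F x\<close> is the stated
  formula.\<close>

lemma orthonormal_complement:
  fixes X C S :: "real mat"
  assumes X: "X \<in> carrier_mat n p" and pn: "p \<le> n" and C: "C \<in> carrier_mat p p"
    and inv: "invertible_mat C" and orth: "orthonormal_cols (X * the (mat_inverse C))"
    and S: "S \<in> carrier_mat p p"
    and DSD: "(C - first_rows p X) * (S * (C - first_rows p X)) = C - first_rows p X"
  shows "\<exists>M \<in> carrier_mat n (n - p).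
    cols_orthonormal_basis n M (vec_module.orthogonal_complement n (vec_space.col_space n X)) \<and>
    (\<forall>x \<in> vec_module.orthogonal_complement n (vec_space.col_space n X).
      M\<^sup>T *\<^sub>v x = vec_last x (n - p) + last_rows (n - p) X *\<^sub>v (S *\<^sub>v vec_first x p))"
proof -
  define Ci where "Ci = the (mat_inverse C)"
  note Ci = invertible_mat_inverse[OF C inv, folded Ci_def]
  define E1 where "E1 = (first_rows p (1\<^sub>m n) :: real mat)"
  define E2 where "E2 = (last_rows (n - p) (1\<^sub>m n) :: real mat)"
  note E = row_partition[OF pn, folded E1_def E2_def]
  define Q where "Q = X * Ci"
  define A where "A = first_rows p X"
  define B where "B = last_rows (n - p) X"
  define D where "D = C - A"
  define N where "N = B * S"
  define G where "G = 1\<^sub>m p - S * D"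
  have AE: "A = E1 * X" unfolding A_def E1_def by (rule first_rows_eq_mult[OF X pn])
  have BE: "B = E2 * X" unfolding B_def E2_def by (rule last_rows_eq_mult[OF X]) simp
  have d [simp]: "dim_row X = n" "dim_col X = p" "dim_row C = p" "dim_col C = p"
    "dim_row S = p" "dim_col S = p" "dim_row Ci = p" "dim_col Ci = p"
    "dim_row E1 = p" "dim_col E1 = n" "dim_row E2 = n - p" "dim_col E2 = n"
    using X C S Ci by (simp_all add: E1_def E2_def first_rows_def last_rows_def)
  have d2 [simp]: "dim_row A = p" "dim_col A = p" "dim_row B = n - p" "dim_col B = p"
     "dim_row Q = n" "dim_col Q = p" by (simp_all add: AE BE Q_def)
  have d3 [simp]: "dim_row D = p" "dim_col D = p" by (simp_all add: D_def)
  have d4 [simp]: "dim_row N = n - p" "dim_col N = p" "dim_row G = p" "dim_col G = p"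
    by (simp_all add: N_def G_def)
  have QQ: "Q\<^sup>T * Q = 1\<^sub>m p" using orth by (simp add: orthonormal_cols_iff Ci_def[symmetric] Q_def[symmetric])
  have XQ: "X = Q * C" by (simp add: Q_def mat_assoc Ci mat_one_mult)
  have QX: "Q\<^sup>T * X = C"
    using arg_cong[OF QQ, of "\<lambda>Y. Y * C"] by (simp add: XQ mat_assoc mat_one_mult)
  \<comment> \<open>Both sides equal \<open>X\<^sup>T * X\<close>: once by \<open>X = Q * C\<close>
    with orthonormal columns of \<open>Q\<close>, once by splitting the rows of
    \<open>X\<close>.\<close>
  have gram: "C\<^sup>T * C = A\<^sup>T * A + B\<^sup>T * B"
  proof -
    have "C\<^sup>T * C = (Q * C)\<^sup>T * X"
      using QX by (simp add: mat_transpose_mult mat_assoc)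
    also have "\<dots> = X\<^sup>T * (1\<^sub>m n * X)" by (simp add: XQ[symmetric] mat_one_mult)
    also have "\<dots> = A\<^sup>T * A + B\<^sup>T * B"
      by (simp add: E(5)[symmetric] AE BE mat_expand)
    finally show ?thesis .
  qed
  have "D * G = 0\<^sub>m p p"
    by (rule eq_matI) (use DSD[folded A_def, folded D_def] in \<open>simp_all add: G_def mat_expand del: index_mult_mat(1)\<close>)
  then have "C * G - A * G = 0\<^sub>m p p" by (simp add: D_def mat_minus_mult)
  then have CG: "C * G = A * G"
    by (intro eq_matI) (simp_all add: mat_eq_iff del: index_mult_mat(1))
  \<comment> \<open>\<open>C\<close> and \<open>A\<close> agree on the range of \<open>G\<close>, so
    their terms in \<open>gram\<close> cancel and that of \<open>B\<close> must vanish.\<close>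
  have "(B * G)\<^sup>T * (B * G) = 0\<^sub>m p p"
  proof -
    have "G\<^sup>T * (C\<^sup>T * (C * G)) = G\<^sup>T * ((A\<^sup>T * A + B\<^sup>T * B) * G)"
      using gram by (simp add: mat_assoc[symmetric] del: assoc_mult_mat)
    also have "\<dots> = G\<^sup>T * (A\<^sup>T * (A * G)) + G\<^sup>T * (B\<^sup>T * (B * G))"
      by (simp add: mat_expand)
    also have "G\<^sup>T * (A\<^sup>T * (A * G)) = G\<^sup>T * (C\<^sup>T * (C * G))"
    proof -
      have "(A * G)\<^sup>T * (A * G) = (C * G)\<^sup>T * (C * G)" by (simp only: CG)
      then show ?thesis by (simp add: mat_transpose_mult mat_assoc)
    qed
    finally have *: "G\<^sup>T * (C\<^sup>T * (C * G)) = G\<^sup>T * (C\<^sup>T * (C * G)) + G\<^sup>T * (B\<^sup>T * (B * G))" .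
    have "G\<^sup>T * (B\<^sup>T * (B * G)) = 0\<^sub>m p p"
      by (rule eq_matI) (use * in \<open>simp_all add: mat_eq_iff del: index_mult_mat(1)\<close>)
    then show ?thesis by (simp add: mat_transpose_mult mat_assoc)
  qed
  then have BG: "B * G = 0\<^sub>m (n - p) p" using mat_transpose_mult_self_eq_0[of "B * G"] by simp
  have ND: "N * D = B"
    by (rule eq_matI) (use BG in \<open>simp_all add: mat_eq_iff G_def N_def mat_expand del: index_mult_mat(1)\<close>)
  have "C = D + A" by (rule eq_matI) (simp_all add: D_def)
  then have NC: "N * C = B + N * A" by (simp add: mat_mult_add ND)

  define F where "F = E2 + N * (E1 - Q\<^sup>T)"
  define M where "M = F\<^sup>T"
  have dF [simp]: "dim_row F = n - p" "dim_col F = n" "dim_row M = n" "dim_col M = n - p"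
    by (simp_all add: F_def M_def)
  \<comment> \<open>\<open>F * X\<close> is \<open>B + N * A - N * C\<close>, which is zero by
    \<open>NC\<close>.\<close>
  have FX: "F * X = 0\<^sub>m (n - p) p"
    by (rule eq_matI)
      (simp_all add: F_def mat_expand QX NC AE[symmetric] BE[symmetric] del: index_mult_mat(1))
  have FQ: "F * Q = 0\<^sub>m (n - p) p"
    using arg_cong[OF FX, of "\<lambda>Y. Y * Ci"] by (simp add: mat_assoc Q_def mat_zero_mult)
  have "E2 * Q + N * (E1 * Q) = N"
  proof -
    have "E2 * Q + N * (E1 * Q) = (B + N * A) * Ci"
      by (simp add: Q_def AE BE mat_expand)
    then show ?thesis by (simp add: NC[symmetric] mat_assoc Ci mat_one_mult)
  qed
  from arg_cong[OF this, of transpose_mat]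
  have NT: "Q\<^sup>T * E2\<^sup>T + Q\<^sup>T * (E1\<^sup>T * N\<^sup>T) = N\<^sup>T"
    by (simp add: mat_expand)
  \<comment> \<open>By \<open>F * Q = 0\<close> the term of \<open>M\<close> with the factor
    \<open>Q\<close> drops out; expanding \<open>N * N\<^sup>T\<close> by \<open>NT\<close> then
    cancels all but the identity.\<close>
  have FF: "F * M = 1\<^sub>m (n - p)"
  proof -
    have "M = E2\<^sup>T + (E1\<^sup>T * N\<^sup>T - Q * N\<^sup>T)" by (simp add: M_def F_def mat_expand)
    then have "F * M = F * E2\<^sup>T + (F * (E1\<^sup>T * N\<^sup>T) - F * Q * N\<^sup>T)"
      by (simp add: mat_expand)
    also have "F * Q * N\<^sup>T = 0\<^sub>m (n - p) (n - p)"
      unfolding FQ by (simp add: mat_zero_mult)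
    also have "F * E2\<^sup>T = 1\<^sub>m (n - p) - N * (Q\<^sup>T * E2\<^sup>T)"
      by (rule eq_matI) (simp_all add: F_def mat_expand E del: index_mult_mat(1))
    also have "F * (E1\<^sup>T * N\<^sup>T) = N * N\<^sup>T - N * (Q\<^sup>T * (E1\<^sup>T * N\<^sup>T))"
    proof -
      have "F * E1\<^sup>T = N - N * (Q\<^sup>T * E1\<^sup>T)"
        by (rule eq_matI) (simp_all add: F_def mat_expand E del: index_mult_mat(1))
      from arg_cong[OF this, of "\<lambda>Y. Y * N\<^sup>T"] show ?thesis by (simp add: mat_expand)
    qed
    also have "N * N\<^sup>T = N * (Q\<^sup>T * E2\<^sup>T) + N * (Q\<^sup>T * (E1\<^sup>T * N\<^sup>T))"
      by (subst NT[symmetric]) (simp add: mat_mult_add)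
    finally show ?thesis
      by (intro eq_matI) (simp_all del: index_mult_mat(1))
  qed
  have MM: "M\<^sup>T * M = 1\<^sub>m (n - p)" using FF by (simp add: M_def)
  have QM: "Q\<^sup>T * M = 0\<^sub>m p (n - p)"
    using arg_cong[OF FQ, of transpose_mat] by (simp add: mat_transpose_mult M_def zero_transpose_mat)
  have MQ: "M\<^sup>T * Q = 0\<^sub>m (n - p) p" using FQ by (simp add: M_def)
  have complete: "Q * Q\<^sup>T + M * M\<^sup>T = 1\<^sub>m n"
  proof -
    \<comment> \<open>\<open>U\<close> is the square matrix with \<open>Q\<close> and
      \<open>M\<close> side by side. A left inverse of a square matrix is a right inverse, so
      \<open>U\<^sup>T * U = 1\<close> yields \<open>U * U\<^sup>T = 1\<close>.\<close>
    define U where "U = Q * E1 + M * E2"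
    have tail: "Q\<^sup>T * (Q * E1) = E1" "M\<^sup>T * (M * E2) = E2" "Q\<^sup>T * (M * E2) = 0\<^sub>m p n" "M\<^sup>T * (Q * E1) = 0\<^sub>m (n - p) n"
      using arg_cong[OF QQ, of "\<lambda>Y. Y * E1"] arg_cong[OF MM, of "\<lambda>Y. Y * E2"]
        arg_cong[OF QM, of "\<lambda>Y. Y * E2"] arg_cong[OF MQ, of "\<lambda>Y. Y * E1"]
      by (simp_all add: mat_assoc mat_one_mult mat_zero_mult)
    have "U\<^sup>T * U = E1\<^sup>T * E1 + E2\<^sup>T * E2"
      by (rule eq_matI) (simp_all add: U_def mat_expand tail del: index_mult_mat(1))
    then have "U\<^sup>T * U = 1\<^sub>m n" by (simp add: E)
    then have "U * U\<^sup>T = 1\<^sub>m n"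
      by (rule mat_mult_left_right_inverse[rotated 2]) (auto intro!: carrier_matI simp: U_def)
    moreover have Etail: "E1 * (E1\<^sup>T * Q\<^sup>T) = Q\<^sup>T" "E2 * (E2\<^sup>T * M\<^sup>T) = M\<^sup>T"
        "E1 * (E2\<^sup>T * M\<^sup>T) = 0\<^sub>m p n" "E2 * (E1\<^sup>T * Q\<^sup>T) = 0\<^sub>m (n - p) n"
      using arg_cong[OF E(1), of "\<lambda>Y. Y * Q\<^sup>T"] arg_cong[OF E(2), of "\<lambda>Y. Y * M\<^sup>T"]
        arg_cong[OF E(3), of "\<lambda>Y. Y * M\<^sup>T"] arg_cong[OF E(4), of "\<lambda>Y. Y * Q\<^sup>T"]
      by (simp_all add: mat_assoc mat_one_mult mat_zero_mult)
    have "U * U\<^sup>T = Q * Q\<^sup>T + M * M\<^sup>T"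
      by (rule eq_matI) (simp_all add: U_def mat_expand Etail del: index_mult_mat(1))
    ultimately show ?thesis by simp
  qed
  interpret vec_space "TYPE(real)" n .
  have cM: "M \<in> carrier_mat n (n - p)" by (rule carrier_matI) simp_all
  have cQ: "Q \<in> carrier_mat n p" by (rule carrier_matI) simp_all
  have cMT: "M\<^sup>T \<in> carrier_mat (n - p) n" and cQT: "Q\<^sup>T \<in> carrier_mat p n"
    using cM cQ by simp_all
  let ?W = "orthogonal_complement (col_space X)"
  have W: "?W = {x \<in> carrier_vec n. X\<^sup>T *\<^sub>v x = 0\<^sub>v p}" by (rule orthogonal_complement_col_space[OF X])
  have Qx: "Q\<^sup>T *\<^sub>v x = 0\<^sub>v p" if "x \<in> ?W" for x
  proof -
    have xc: "x \<in> carrier_vec n" and Xx: "X\<^sup>T *\<^sub>v x = 0\<^sub>v p" using that unfolding W by blast+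
    have T: "Ci\<^sup>T \<in> carrier_mat p p" "X\<^sup>T \<in> carrier_mat p n" using Ci(1) X by simp_all
    have "Q\<^sup>T *\<^sub>v x = (Ci\<^sup>T * X\<^sup>T) *\<^sub>v x" by (simp add: Q_def mat_transpose_mult)
    also have "\<dots> = Ci\<^sup>T *\<^sub>v (X\<^sup>T *\<^sub>v x)" by (rule assoc_mult_mat_vec[OF T xc])
    also have "\<dots> = 0\<^sub>v p" unfolding Xx using T(1) by auto
    finally show ?thesis .
  qed
  \<comment> \<open>By \<open>complete\<close> and \<open>Q\<^sup>T x = 0\<close>, a vector
    \<open>x\<close> of the complement is \<open>M (M\<^sup>T x)\<close>; the converse is
    \<open>FX\<close> transposed.\<close>
  have "?W = col_space M"
  proof (intro equalityI subsetI)
    fix x assume x: "x \<in> ?W"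
    then have xc: "x \<in> carrier_vec n" using W by simp
    have "x = (Q * Q\<^sup>T + M * M\<^sup>T) *\<^sub>v x" using xc by (simp add: complete)
    also have "\<dots> = Q *\<^sub>v (Q\<^sup>T *\<^sub>v x) + M *\<^sub>v (M\<^sup>T *\<^sub>v x)"
      using add_mult_distrib_mat_vec[OF mult_carrier_mat[OF cQ cQT] mult_carrier_mat[OF cM cMT] xc]
        assoc_mult_mat_vec[OF cQ cQT xc] assoc_mult_mat_vec[OF cM cMT xc] by simp
    also have "\<dots> = M *\<^sub>v (M\<^sup>T *\<^sub>v x)" 
    proof -
      have "Q *\<^sub>v 0\<^sub>v p = 0\<^sub>v n" using cQ by auto
      then show ?thesis
        unfolding Qx[OF x]
        using left_zero_vec[OF mult_mat_vec_carrier[OF cM mult_mat_vec_carrier[OF cMT xc]]] by simp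
    qed
    finally show "x \<in> col_space M"
      using xc cM unfolding col_space_eq[OF cM] by (auto intro!: bexI[of _ "M\<^sup>T *\<^sub>v x"])
  next
    fix x assume "x \<in> col_space M"
    then obtain y where y: "y \<in> carrier_vec (n - p)" "x = M *\<^sub>v y"
      using cM by (auto simp: col_space_eq[OF cM])
    have XM: "X\<^sup>T * M = 0\<^sub>m p (n - p)"
      using arg_cong[OF FX, of transpose_mat] by (simp add: mat_transpose_mult M_def zero_transpose_mat)
    have "X\<^sup>T *\<^sub>v x = (X\<^sup>T * M) *\<^sub>v y"
      unfolding y(2) by (rule assoc_mult_mat_vec[symmetric, of _ p n _ "n - p"]) (use X cM y in simp_all)
    also have "\<dots> = 0\<^sub>v p" unfolding XM using y(1) by auto
    finally show "x \<in> ?W" unfolding W using mult_mat_vec_carrier[OF cM y(1)] y(2) by blast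
  qed
  then have "cols_orthonormal_basis n M ?W"
    using cols_orthonormal_basis_col_space[OF cM MM] by simp
  moreover have "M\<^sup>T *\<^sub>v x = vec_last x (n - p) + last_rows (n - p) X *\<^sub>v (S *\<^sub>v vec_first x p)"
    if x: "x \<in> ?W" for x
  proof -
    have xc: "x \<in> carrier_vec n" using x W by simp
    have c: "E1 \<in> carrier_mat p n" "E2 \<in> carrier_mat (n - p) n" "Q\<^sup>T \<in> carrier_mat p n"
      "N \<in> carrier_mat (n - p) p" "B \<in> carrier_mat (n - p) p" "E1 - Q\<^sup>T \<in> carrier_mat p n"
      "N * (E1 - Q\<^sup>T) \<in> carrier_mat (n - p) n" "E1 *\<^sub>v x \<in> carrier_vec p"
      by (auto intro!: carrier_matI carrier_vecI)
    have "M\<^sup>T *\<^sub>v x = E2 *\<^sub>v x + (N * (E1 - Q\<^sup>T)) *\<^sub>v x"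
      by (simp add: M_def F_def add_mult_distrib_mat_vec[OF c(2,7) xc])
    also have "(N * (E1 - Q\<^sup>T)) *\<^sub>v x = N *\<^sub>v (E1 *\<^sub>v x - Q\<^sup>T *\<^sub>v x)"
      by (simp add: assoc_mult_mat_vec[OF c(4,6) xc] minus_mult_distrib_mat_vec[OF c(1,3) xc])
    also have "E1 *\<^sub>v x - Q\<^sup>T *\<^sub>v x = E1 *\<^sub>v x" using Qx[OF x] c(8) by simp
    also have "N *\<^sub>v (E1 *\<^sub>v x) = B *\<^sub>v (S *\<^sub>v (E1 *\<^sub>v x))"
      unfolding N_def by (rule assoc_mult_mat_vec[OF c(5) S c(8)])
    finally show ?thesis
      using vec_first_eq_mult[OF xc pn] vec_last_eq_mult[OF xc, of "n - p"]
      by (simp add: E1_def E2_def B_def)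
  qed
  ultimately show ?thesis using cM by blast
qed

theorem theorem2:
  shows "\<exists>(alg :: com) (T :: nat \<Rightarrow> nat).
    (\<lambda>p. real (T p)) \<in> O(\<lambda>p. real p ^ 3) \<and>
    (\<forall>(n :: nat) (p :: nat) (X :: real mat) (C :: real mat).
      X \<in> carrier_mat n p \<longrightarrow> p < n \<longrightarrow> vec_space.rank n X = p \<longrightarrow>
      C \<in> carrier_mat p p \<longrightarrow> invertible_mat C \<longrightarrow>
      orthonormal_cols (X * the (mat_inverse C)) \<longrightarrow>
      (\<exists>M S. M \<in> carrier_mat n (n - p) \<and>
        cols_orthonormal_basis n M
          (vec_module.orthogonal_complement n (vec_space.col_space n X)) \<and>
        S \<in> carrier_mat p p \<and>
        vec_space.rank p S = vec_space.rank p (C - first_rows p X) \<and>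
        (\<forall>x \<in> vec_module.orthogonal_complement n (vec_space.col_space n X).
          M\<^sup>T *\<^sub>v x =
            vec_last x (n - p) + last_rows (n - p) X *\<^sub>v (S *\<^sub>v vec_first x p)) \<and>
        (invertible_mat (C - first_rows p X) \<longrightarrow>
          S = the (mat_inverse (C - first_rows p X))) \<and>
        computes_within alg p (first_rows p X) C (T p) S))"
proof (rule exI[of _ bordered_elimination], rule exI[of _ "\<lambda>p. 27 * p ^ 3"], intro conjI allI impI)
  show "(\<lambda>p. real (27 * p ^ 3)) \<in> O(\<lambda>p. real p ^ 3)"
    by (rule bigoI[where c = 27]) simp
next
  fix n p and X C :: "real mat"
  assume X: "X \<in> carrier_mat n p" and pn: "p < n"
    and C: "C \<in> carrier_mat p p" and inv: "invertible_mat C"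
    and orth: "orthonormal_cols (X * the (mat_inverse C))"
  define D where "D = C - first_rows p X"
  have A: "first_rows p X \<in> carrier_mat p p" using X by (simp add: first_rows_def)
  then have D: "D \<in> carrier_mat p p" unfolding D_def by (rule minus_carrier_mat)
  \<comment> \<open>The witness \<open>S\<close> is read from the final state of the run, so the
    computed matrix is the one in the formula.\<close>
  obtain t s m where run: "exec bordered_elimination (input_state p (first_rows p X) C) t (s, m)"
    "t \<le> 27 * p ^ 3"
    and inverse: "D * (mat p p (m ''S'') * D) = D"
      "mat p p (m ''S'') * (D * mat p p (m ''S'')) = mat p p (m ''S'')"
    using runs_bordered_elimination[OF A C] unfolding runs_def D_def by auto
  define S where "S = mat p p (m ''S'')"
  note inverse = inverse[folded S_def]
  have S: "S \<in> carrier_mat p p" by (simp add: S_def)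
  obtain M where "M \<in> carrier_mat n (n - p)"
    "cols_orthonormal_basis n M (vec_module.orthogonal_complement n (vec_space.col_space n X))"
    "\<forall>x \<in> vec_module.orthogonal_complement n (vec_space.col_space n X).
      M\<^sup>T *\<^sub>v x = vec_last x (n - p) + last_rows (n - p) X *\<^sub>v (S *\<^sub>v vec_first x p)"
    using orthonormal_complement[OF X less_imp_le[OF pn] C inv orth S] inverse(1)[unfolded D_def] by blast
  \<comment> \<open>\<open>D\<close> and \<open>S\<close> are generalized inverses of each other, so
    the rank inequality holds both ways.\<close>
  moreover have "vec_space.rank p S = vec_space.rank p D"
    using vec_space.rank_generalized_inverse_le[OF D S inverse(1)]
      vec_space.rank_generalized_inverse_le[OF S D inverse(2)] by (rule antisym[rotated])
  moreover have "S = the (mat_inverse D)" if "invertible_mat D"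
    by (rule generalized_inverse_of_invertible[OF D S inverse(1) that])
  moreover have "computes_within bordered_elimination p (first_rows p X) C (27 * p ^ 3) S"
    unfolding computes_within_def S_def using run by blast
  ultimately show "\<exists>M S. M \<in> carrier_mat n (n - p) \<and>
      cols_orthonormal_basis n M
        (vec_module.orthogonal_complement n (vec_space.col_space n X)) \<and>
      S \<in> carrier_mat p p \<and>
      vec_space.rank p S = vec_space.rank p (C - first_rows p X) \<and>
      (\<forall>x \<in> vec_module.orthogonal_complement n (vec_space.col_space n X).
        M\<^sup>T *\<^sub>v x =
          vec_last x (n - p) + last_rows (n - p) X *\<^sub>v (S *\<^sub>v vec_first x p)) \<and>
      (invertible_mat (C - first_rows p X) \<longrightarrow>
        S = the (mat_inverse (C - first_rows p X))) \<and>
      computes_within bordered_elimination p (first_rows p X) C (27 * p ^ 3) S"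
    using S unfolding D_def by blast
qed

end
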